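(* Let $\mathbb{F}$ be a field with $\mathrm{char}(\mathbb{F})\neq 2,3$. Every ideal of $\hat{\mathcal{H}}$ is principal.
   Context: Notation: $\mathbb{N}=\{1,2,3,\dots\}$, $3\mathbb{N}=\{3,6,9,\dots\}$; for $r\in\mathbb{Z}$, $\bar r=r+3\mathbb{Z}\in\mathbb{Z}_3$. The algebra $\hat{\mathcal{H}}$ is the commutative $\mathbb{F}$-algebra with basis $\{a_i:i\in\mathbb{Z}\}\cup\{s_j:j\in\mathbb{N}\}\cup\{p_{\bar r,k}:\bar r\in\{\bar1,\bar2\},\ k\in 3\mathbb{N}\}$, where $s_0=0$, $p_{\bar r,j}=0$ for all $\bar r$ whenever $j\notin 3\mathbb{N}$, $p_{\bar 0,j}=-p_{\bar1,j}-p_{\bar2,j}$, $z_{\bar r,j}=p_{\bar r+\bar1,j}-p_{\bar r-\bar1,j}$, and for $i,i'\in\mathbb{Z}$, $j,l\in\mathbb{N}$, $h,k\in3\mathbb{N}$, $\bar r,\bar t\in\mathbb{Z}_3$: (H1) $a_ia_{i'}=\tfrac12(a_i+a_{i'})+s_{|i-i'|}+z_{\bar\imath,|i-i'|}$; (H2) $a_is_j=-\tfrac34a_i+\tfrac38(a_{i-j}+a_{i+j})+\tfrac32 s_j-z_{\bar\imath,j}$; (H3) $a_ip_{\bar r,k}=\tfrac32p_{\bar r,k}-p_{-(\bar\imath+\bar r),k}$; (H4) $s_js_l=\tfrac34(s_j+s_l)-\tfrac38(s_{|j-l|}+s_{j+l})$; (H5) $s_jp_{\bar r,k}=\tfrac34(p_{\bar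 r,j}+p_{\bar r,k})-\tfrac38(p_{\bar r,|j-k|}+p_{\bar r,j+k})$; (H6) $p_{\bar r,h}p_{\bar t,k}=\tfrac14(z_{-(\bar r+\bar t),h}+z_{-(\bar r+\bar t),k})-\tfrac18(z_{-(\bar r+\bar t),|h-k|}+z_{-(\bar r+\bar t),h+k})$. *)

theory Defs
  imports Main
begin

text \<open>Index set of the basis of the algebra hat-H:
  HA i  ~  a_i  (i in Z);
  HS j  ~  s_j  (j >= 1);
  HP r k ~ p_{r,k}  (r in {1,2} representing residues mod 3, k in 3N).
  Elements of hat-H are finitely supported coefficient functions on valid indices.\<close>

datatype hidx = HA int | HS nat | HP int nat

definition hvalid :: "hidx \<Rightarrow> bool" where
  "hvalid b = (case b of HA i \<Rightarrow> True
                       | HS j \<Rightarrow> j \<ge> 1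
                       | HP r k \<Rightarrow> (r = 1 \<or> r = 2) \<and> k > 0 \<and> 3 dvd k)"

type_synonym 'a hvec = "hidx \<Rightarrow> 'a"

definition hsupp :: "('a::zero) hvec \<Rightarrow> hidx set" where
  "hsupp x = {b. x b \<noteq> 0}"

definition hcarrier :: "('a::field) hvec set" where
  "hcarrier = {x. finite (hsupp x) \<and> (\<forall>b. x b \<noteq> 0 \<longrightarrow> hvalid b)}"

definition vzero :: "('a::field) hvec" where "vzero = (\<lambda>_. 0)"
definition vadd :: "('a::field) hvec \<Rightarrow> 'a hvec \<Rightarrow> 'a hvec" where
  "vadd x y = (\<lambda>m. x m + y m)"
definition vsub :: "('a::field) hvec \<Rightarrow> 'a hvec \<Rightarrow> 'a hvec" where
  "vsub x y = (\<lambda>m. x m - y m)"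
definition vsmul :: "'a::field \<Rightarrow> 'a hvec \<Rightarrow> 'a hvec" where
  "vsmul c x = (\<lambda>m. c * x m)"
definition vbasis :: "hidx \<Rightarrow> ('a::field) hvec" where
  "vbasis b = (\<lambda>m. if m = b then 1 else 0)"

definition ha :: "int \<Rightarrow> ('a::field) hvec" where "ha i = vbasis (HA i)"
definition hs :: "nat \<Rightarrow> ('a::field) hvec" where
  "hs j = (if j = 0 then vzero else vbasis (HS j))"
definition hp :: "int \<Rightarrow> nat \<Rightarrow> ('a::field) hvec" where
  "hp r k = (if k > 0 \<and> 3 dvd k then
               (if r mod 3 = 1 then vbasis (HP 1 k)
                else if r mod 3 = 2 then vbasis (HP 2 k)
                else vsub (vsmul (-1) (vbasis (HP 1 k))) (vbasis (HP 2 k)))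
             else vzero)"
definition hz :: "int \<Rightarrow> nat \<Rightarrow> ('a::field) hvec" where
  "hz r j = vsub (hp (r + 1) j) (hp (r - 1) j)"

fun hbm :: "hidx \<Rightarrow> hidx \<Rightarrow> ('a::field) hvec" where
  "hbm (HA i) (HA i') =
     vadd (vadd (vsmul (1/2) (vadd (ha i) (ha i'))) (hs (nat \<bar>i - i'\<bar>))) (hz i (nat \<bar>i - i'\<bar>))"
| "hbm (HA i) (HS j) =
     vsub (vadd (vadd (vsmul (-(3/4)) (ha i)) (vsmul (3/8) (vadd (ha (i - int j)) (ha (i + int j)))))
                (vsmul (3/2) (hs j)))
          (hz i j)"
| "hbm (HS j) (HA i) =
     vsub (vadd (vadd (vsmul (-(3/4)) (ha i)) (vsmul (3/8) (vadd (ha (i - int j)) (ha (i + int j)))))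
                (vsmul (3/2) (hs j)))
          (hz i j)"
| "hbm (HA i) (HP r k) = vsub (vsmul (3/2) (hp r k)) (hp (-(i + r)) k)"
| "hbm (HP r k) (HA i) = vsub (vsmul (3/2) (hp r k)) (hp (-(i + r)) k)"
| "hbm (HS j) (HS l) =
     vsub (vsmul (3/4) (vadd (hs j) (hs l)))
          (vsmul (3/8) (vadd (hs (nat \<bar>int j - int l\<bar>)) (hs (j + l))))"
| "hbm (HS j) (HP r k) =
     vsub (vsmul (3/4) (vadd (hp r j) (hp r k)))
          (vsmul (3/8) (vadd (hp r (nat \<bar>int j - int k\<bar>)) (hp r (j + k))))"
| "hbm (HP r k) (HS j) =
     vsub (vsmul (3/4) (vadd (hp r j) (hp r k)))
          (vsmul (3/8) (vadd (hp r (nat \<bar>int j - int k\<bar>)) (hp r (j + k))))"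
| "hbm (HP r h) (HP t k) =
     vsub (vsmul (1/4) (vadd (hz (-(r + t)) h) (hz (-(r + t)) k)))
          (vsmul (1/8) (vadd (hz (-(r + t)) (nat \<bar>int h - int k\<bar>)) (hz (-(r + t)) (h + k))))"

definition hmult :: "('a::field) hvec \<Rightarrow> 'a hvec \<Rightarrow> 'a hvec" where
  "hmult x y = (\<lambda>m. \<Sum>b1\<in>hsupp x. \<Sum>b2\<in>hsupp y. x b1 * y b2 * hbm b1 b2 m)"

definition hideal :: "('a::field) hvec set \<Rightarrow> bool" where
  "hideal I \<longleftrightarrow> I \<subseteq> hcarrier \<and> vzero \<in> I
     \<and> (\<forall>x\<in>I. \<forall>y\<in>I. vadd x y \<in> I)
     \<and> (\<forall>c. \<forall>x\<in>I. vsmul c x \<in> I)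
     \<and> (\<forall>h\<in>hcarrier. \<forall>x\<in>I. hmult h x \<in> I)"

definition hgen_ideal :: "('a::field) hvec \<Rightarrow> 'a hvec set" where
  "hgen_ideal a = \<Inter>{J. hideal J \<and> a \<in> J}"

end

theory Submission
  imports Defs "HOL-Computational_Algebra.Polynomial" "HOL-Library.Function_Algebras"
begin

text \<open>With \<open>a\<^sub>i = x\<^sup>i\<close> and \<open>s\<^sub>j = -3/8 (x\<^sup>j + x\<^sup>-\<^sup>j - 2)\<close>, modulo the ideal \<open>P\<close> spanned by the \<open>p\<close> all
  products on the elements of weight 0 (those with coefficient sum 0 over the \<open>a\<^sub>i\<close>) are linear over the
  polynomial ring in \<open>x + x\<^sup>-\<^sup>1\<close>, and \<open>a\<^sub>0\<close> acts on them with the distinct eigenvalues 0, 2 and 1/2. The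
  eigenspaces have rank one over this principal ideal domain, so an ideal of elements of weight 0 is, modulo
  \<open>P\<close>, generated by the sum of the generators of its eigencomponents. Its intersection with \<open>P\<close> is
  likewise governed by one polynomial in \<open>s\<^sub>3\<close>, since \<open>a\<^sub>0\<close> and \<open>a\<^sub>1\<close> act irreducibly on
  \<open>p\<^sub>0, p\<^sub>1, p\<^sub>2\<close>. An element of the multiplication algebra that maps weight 0 into \<open>P\<close> and is nonzero on
  the vectors \<open>p\<^sub>1 - p\<^sub>2\<close> allows one to correct the first generator by an element of \<open>P\<close> so that it also
  generates the intersection with \<open>P\<close>. An ideal not of weight 0 contains the eigenvector \<open>a\<^sub>0\<close> and
  is then the whole algebra.\<close>

section \<open>Linear operators on the carrier\<close>

lemma vsmul_apply [simp]: "vsmul c x m = c * x m"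
  by (simp add: vsmul_def)

lemmas coordwise = fun_eq_iff vsmul_apply plus_fun_apply zero_fun_apply minus_apply uminus_apply
  times_fun_apply numeral_fun_apply

lemma vadd_eq_plus: "vadd x y = x + y"
  by (simp add: vadd_def coordwise)

lemma vsub_eq_minus: "vsub x y = x - y"
  by (simp add: vsub_def coordwise)

lemma vzero_eq_0: "vzero = 0"
  by (simp add: vzero_def coordwise)

lemmas pointwise = vadd_eq_plus vsub_eq_minus vzero_eq_0

interpretation hv: vector_space "vsmul :: 'a::field \<Rightarrow> 'a hvec \<Rightarrow> 'a hvec"
  by standard (simp_all add: coordwise algebra_simps)

lemma subspace_hcarrier [simp]: "hv.subspace (hcarrier :: 'a::field hvec set)"
proof (rule hv.subspaceI)
  fix x y :: "'a hvec" and c :: 'a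
  assume x: "x \<in> hcarrier"
  have "hsupp (vsmul c x) \<subseteq> hsupp x"
    by (auto simp: hsupp_def)
  then show "vsmul c x \<in> hcarrier"
    using x by (auto simp: hcarrier_def intro: finite_subset)
  assume y: "y \<in> hcarrier"
  have "hsupp (x + y) \<subseteq> hsupp x \<union> hsupp y"
    by (auto simp: hsupp_def)
  moreover have "finite (hsupp x \<union> hsupp y)"
    using x y by (simp add: hcarrier_def)
  ultimately have "finite (hsupp (x + y))"
    by (rule finite_subset)
  then show "x + y \<in> hcarrier"
    using x y by (auto simp: hcarrier_def) (metis add_0)
qed (simp add: hcarrier_def hsupp_def)

lemmas hcarrier_closed [simp] =
  hv.subspace_0[OF subspace_hcarrier] hv.subspace_add[OF subspace_hcarrier]
  hv.subspace_diff[OF subspace_hcarrier] hv.subspace_neg[OF subspace_hcarrier]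
  hv.subspace_scale[OF subspace_hcarrier]

lemma vbasis_in_hcarrier [simp]: "hvalid b \<Longrightarrow> vbasis b \<in> hcarrier"
  by (simp add: hcarrier_def hsupp_def vbasis_def)

lemma ha_in_hcarrier [simp]: "ha i \<in> hcarrier"
  by (simp add: ha_def hvalid_def)

lemma hs_in_hcarrier [simp]: "hs j \<in> hcarrier"
  by (simp add: hs_def hvalid_def pointwise)

lemma hp_in_hcarrier [simp]: "hp r k \<in> hcarrier"
  by (simp add: hp_def hvalid_def pointwise)

lemma hz_in_hcarrier [simp]: "hz r k \<in> hcarrier"
  by (simp add: hz_def pointwise)

lemma hbm_in_hcarrier: "hbm b c \<in> hcarrier"
  by (induction b c rule: hbm.induct)
    (simp_all only: hbm.simps pointwise hcarrier_closed ha_in_hcarrier hs_in_hcarrier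
      hp_in_hcarrier hz_in_hcarrier)

lemma sum_vbasis:
  assumes "finite A" "hsupp x \<subseteq> A"
  shows "(\<Sum>b\<in>A. vsmul (x b) (vbasis b)) = x"
proof
  fix m
  have "(\<Sum>b\<in>A. vsmul (x b) (vbasis b)) m = (\<Sum>b\<in>A. vsmul (x b) (vbasis b) m)"
    using assms(1) by induction auto
  also have "\<dots> = (\<Sum>b\<in>A. if m = b then x b else 0)"
    by (intro sum.cong) (auto simp: vbasis_def)
  also have "\<dots> = x m"
    using assms by (auto simp: hsupp_def)
  finally show "(\<Sum>b\<in>A. vsmul (x b) (vbasis b)) m = x m" .
qed

lemma hcarrier_subset:
  assumes V: "hv.subspace V"
    and "\<And>i. ha i \<in> V" "\<And>j. hs j \<in> V" "\<And>r k. hp r k \<in> V"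
  shows "hcarrier \<subseteq> V"
proof
  have *: "vbasis b \<in> V" if "hvalid b" for b
  proof (cases b)
    case (HA i)
    then show ?thesis using assms(2)[of i] by (simp add: ha_def)
  next
    case (HS j)
    then show ?thesis using assms(3)[of j] that by (simp add: hs_def hvalid_def split: if_splits)
  next
    case (HP r k)
    then show ?thesis using assms(4)[of r k] that by (auto simp: hp_def hvalid_def)
  qed
  fix x :: "'a hvec" assume "x \<in> hcarrier"
  then have "(\<Sum>b\<in>hsupp x. vsmul (x b) (vbasis b)) \<in> V"
    by (intro hv.subspace_sum[OF V] hv.subspace_scale[OF V] *)
      (auto simp: hcarrier_def hsupp_def)
  with \<open>x \<in> hcarrier\<close> show "x \<in> V"
    by (subst (asm) sum_vbasis) (auto simp: hcarrier_def)
qed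

text \<open>Linearity is demanded on the carrier only: a sum over an infinite support is 0 by
  convention, so multiplication operators need not be additive on arbitrary coefficient
  functions.\<close>

definition linop :: "('a::field hvec \<Rightarrow> 'a hvec) \<Rightarrow> bool" where
  "linop f \<longleftrightarrow> (\<forall>x\<in>hcarrier. f x \<in> hcarrier)
     \<and> (\<forall>x\<in>hcarrier. \<forall>y\<in>hcarrier. f (x + y) = f x + f y)
     \<and> (\<forall>c. \<forall>x\<in>hcarrier. f (vsmul c x) = vsmul c (f x))"

definition lext :: "(hidx \<Rightarrow> 'a::field hvec) \<Rightarrow> 'a hvec \<Rightarrow> 'a hvec" where
  "lext g x = (\<Sum>b\<in>hsupp x. vsmul (x b) (g b))"

lemma lext_superset:
  assumes "finite A" "hsupp x \<subseteq> A"
  shows "lext g x = (\<Sum>b\<in>A. vsmul (x b) (g b))"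
  unfolding lext_def using assms
  by (intro sum.mono_neutral_left) (auto simp: hsupp_def)

lemma lext_vbasis [simp]: "lext g (vbasis b) = g b"
proof -
  have "hsupp (vbasis b :: 'a hvec) = {b}"
    by (auto simp: hsupp_def vbasis_def)
  then show ?thesis by (simp add: lext_def vbasis_def)
qed

lemma linop_lext:
  assumes "\<And>b. g b \<in> hcarrier"
  shows "linop (lext g)"
  unfolding linop_def
proof (intro conjI ballI allI)
  fix x y :: "'a hvec" and c :: 'a
  assume x: "x \<in> hcarrier"
  show "lext g x \<in> hcarrier"
    unfolding lext_def using assms by (intro hv.subspace_sum) auto
  have fin: "finite (hsupp x)" using x by (simp add: hcarrier_def)
  have "lext g (vsmul c x) = (\<Sum>b\<in>hsupp x. vsmul (vsmul c x b) (g b))"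
    by (rule lext_superset[OF fin]) (auto simp: hsupp_def)
  then show "lext g (vsmul c x) = vsmul c (lext g x)"
    by (simp add: lext_def hv.scale_sum_right)
  assume y: "y \<in> hcarrier"
  have A: "finite (hsupp x \<union> hsupp y)" using x y by (simp add: hcarrier_def)
  have "lext g z = (\<Sum>b\<in>hsupp x \<union> hsupp y. vsmul (z b) (g b))" if "z \<in> {x, y, x + y}" for z
    by (rule lext_superset[OF A]) (use that in \<open>auto simp: hsupp_def\<close>)
  then show "lext g (x + y) = lext g x + lext g y"
    by (simp add: hv.scale_left_distrib sum.distrib)
qed

lemma
  assumes "linop f"
  shows linop_closed: "x \<in> hcarrier \<Longrightarrow> f x \<in> hcarrier"
    and linop_add: "x \<in> hcarrier \<Longrightarrow> y \<in> hcarrier \<Longrightarrow> f (x + y) = f x + f y"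
    and linop_scale: "x \<in> hcarrier \<Longrightarrow> f (vsmul c x) = vsmul c (f x)"
  using assms by (auto simp: linop_def)

lemma linop_0: "linop f \<Longrightarrow> f 0 = 0"
  using linop_scale[of f 0 0] by simp

lemma linop_diff:
  assumes "linop f" "x \<in> hcarrier" "y \<in> hcarrier"
  shows "f (x - y) = f x - f y"
  using linop_add[OF assms(1), of "x - y" y] assms by simp

lemma linop_neg: "linop f \<Longrightarrow> x \<in> hcarrier \<Longrightarrow> f (- x) = - f x"
  using linop_diff[of f 0 x] by (simp only: linop_0 diff_0 hcarrier_closed)

lemma hmult_vbasis: "hmult (vbasis b) y = lext (hbm b) y"
proof
  fix m
  have "hsupp (vbasis b :: 'a hvec) = {b}"
    by (auto simp: hsupp_def vbasis_def)
  moreover have "(\<Sum>c\<in>A. vsmul (y c) (hbm b c)) m = (\<Sum>c\<in>A. y c * hbm b c m)" if "finite A" for A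
    using that by induction auto
  then have "lext (hbm b) y m = (\<Sum>c\<in>hsupp y. y c * hbm b c m)"
    unfolding lext_def by (cases "finite (hsupp y)") auto
  ultimately show "hmult (vbasis b) y m = lext (hbm b) y m"
    by (simp add: hmult_def vbasis_def)
qed

lemma linop_mult_ha [simp]: "linop (hmult (ha i))"
  by (simp add: ha_def hmult_vbasis[abs_def] linop_lext hbm_in_hcarrier)

lemma linop_mult_hs [simp]: "linop (hmult (hs j :: 'a::field hvec))"
proof (cases "j = 0")
  case True
  then have "hmult (hs j) = (\<lambda>_. 0 :: 'a hvec)"
    by (simp add: hmult_def hs_def vzero_def hsupp_def fun_eq_iff)
  then show ?thesis by (simp add: linop_def)
next
  case False
  then show ?thesis
    by (simp add: hs_def hmult_vbasis[abs_def] linop_lext hbm_in_hcarrier)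
qed

\<comment> \<open>Instances found by higher-order matching may be eta-expanded; with these rules active the simplifier
  would then rewrite vectors into coordinate functions.\<close>
declare coordwise [simp del]

lemmas mult_ha [simp] = linop_closed[OF linop_mult_ha] linop_add[OF linop_mult_ha]
  linop_scale[OF linop_mult_ha] linop_diff[OF linop_mult_ha] linop_0[OF linop_mult_ha]
  linop_neg[OF linop_mult_ha]

lemmas mult_hs [simp] = linop_closed[OF linop_mult_hs] linop_add[OF linop_mult_hs]
  linop_scale[OF linop_mult_hs] linop_diff[OF linop_mult_hs] linop_0[OF linop_mult_hs]
  linop_neg[OF linop_mult_hs]

lemma linop_eq_on_span:
  assumes "linop f" "linop g" "X \<subseteq> hcarrier" "\<And>x. x \<in> X \<Longrightarrow> f x = g x" "x \<in> hv.span X"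
  shows "f x = g x"
proof -
  have "hv.subspace {x \<in> hcarrier. f x = g x}"
    using assms(1,2)
    by (intro hv.subspaceI) (auto simp: linop_add linop_scale linop_0)
  then have "hv.span X \<subseteq> {x \<in> hcarrier. f x = g x}"
    using assms(3,4) by (intro hv.span_minimal) auto
  with assms(5) show ?thesis by auto
qed

lemma linop_compose: "linop f \<Longrightarrow> linop g \<Longrightarrow> linop (\<lambda>x. f (g x))"
  and linop_plus: "linop f \<Longrightarrow> linop g \<Longrightarrow> linop (\<lambda>x. f x + g x)"
  and linop_minus: "linop f \<Longrightarrow> linop g \<Longrightarrow> linop (\<lambda>x. f x - g x)"
  and linop_uminus: "linop f \<Longrightarrow> linop (\<lambda>x. - f x)"
  and linop_vsmul: "linop f \<Longrightarrow> linop (\<lambda>x. vsmul c (f x))"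
  and linop_ident: "linop (\<lambda>x. x)"
  by (simp_all add: linop_def hv.scale_right_distrib hv.scale_right_diff_distrib mult.commute)

declare One_nat_def [simp del]

lemma hp_0 [simp]: "hp r 0 = 0"
  by (simp add: hp_def pointwise)

lemma hp_not_dvd: "\<not> 3 dvd k \<Longrightarrow> hp r k = 0"
  by (simp add: hp_def pointwise)

lemma hz_0 [simp]: "hz r 0 = 0"
  by (simp add: hz_def pointwise)

lemma hs_0 [simp]: "hs 0 = 0"
  by (simp add: hs_def pointwise)

lemma hp_cong: "r mod 3 = t mod 3 \<Longrightarrow> hp r k = hp t k"
  by (simp add: hp_def)

text \<open>The convention for residue 0, in a form invariant under shifts of \<open>r\<close>: the
  three indices run through all residues modulo 3.\<close>

lemma hp_sum_zero: "hp (r + 1) k + hp (r - 1) k + hp r k = 0"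
proof -
  have "r mod 3 = 0 \<and> (r + 1) mod 3 = 1 \<and> (r - 1) mod 3 = 2 \<or>
        r mod 3 = 1 \<and> (r + 1) mod 3 = 2 \<and> (r - 1) mod 3 = 0 \<or>
        r mod 3 = 2 \<and> (r + 1) mod 3 = 0 \<and> (r - 1) mod 3 = 1" by presburger
  then show ?thesis
    by (elim disjE) (auto simp: hp_def pointwise coordwise)
qed

lemma hz_cong: "r mod 3 = t mod 3 \<Longrightarrow> hz r k = hz t k"
  unfolding hz_def by (metis hp_cong mod_add_left_eq mod_diff_left_eq)

section \<open>The subspaces spanned by the s and by the p\<close>

lemma mod3_cases [case_names 1 2 3]:
  fixes r :: int and P :: bool
  assumes "r mod 3 = 0 \<Longrightarrow> P" "r mod 3 = 1 \<Longrightarrow> P" "r mod 3 = 2 \<Longrightarrow> P"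
  shows P
proof -
  have "r mod 3 = 0 \<or> r mod 3 = 1 \<or> r mod 3 = 2" by presburger
  then show P using assms by (elim disjE)
qed

lemma hmult_hs: "j > 0 \<Longrightarrow> hmult (hs j) = lext (hbm (HS j))"
  by (simp add: hs_def hmult_vbasis[abs_def])

lemma mult_ha_ha:
  "hmult (ha i) (ha j) = vsmul (1/2) (ha i + ha j) + hs (nat \<bar>i - j\<bar>) + hz i (nat \<bar>i - j\<bar>)"
  by (simp only: ha_def hmult_vbasis lext_vbasis hbm.simps pointwise)

definition s_space :: "'a::field hvec set" where
  "s_space = hv.span (range hs)"

definition p_space :: "'a::field hvec set" where
  "p_space = hv.span (range (\<lambda>(r, k). hp r k))"

lemma subspace_s_space [simp]: "hv.subspace s_space" and subspace_p_space [simp]: "hv.subspace p_space"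
  by (simp_all add: s_space_def p_space_def)

lemmas p_space_closed = hv.subspace_0[OF subspace_p_space] hv.subspace_add[OF subspace_p_space]
  hv.subspace_diff[OF subspace_p_space] hv.subspace_neg[OF subspace_p_space]
  hv.subspace_scale[OF subspace_p_space]

lemma hs_in_s_space [simp]: "hs j \<in> s_space"
  by (simp add: s_space_def hv.span_base)

lemma hp_in_p_space [simp]: "hp r k \<in> p_space"
  by (auto simp: p_space_def intro!: hv.span_base)

lemma hz_in_p_space [simp]: "hz r k \<in> p_space"
  by (simp add: hz_def vsub_eq_minus p_space_closed)

lemma p_space_minimal: "hv.subspace V \<Longrightarrow> (\<And>r k. hp r k \<in> V) \<Longrightarrow> p_space \<subseteq> V"
  unfolding p_space_def by (rule hv.span_minimal) auto

lemma s_space_minimal: "hv.subspace V \<Longrightarrow> (\<And>j. hs j \<in> V) \<Longrightarrow> s_space \<subseteq> V"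
  unfolding s_space_def by (rule hv.span_minimal) auto

lemma s_space_in_hcarrier [simp]: "x \<in> s_space \<Longrightarrow> x \<in> hcarrier"
  and p_space_in_hcarrier [simp]: "x \<in> p_space \<Longrightarrow> x \<in> hcarrier"
  using s_space_minimal[OF subspace_hcarrier] p_space_minimal[OF subspace_hcarrier] by auto

lemma linop_subspace_vimage:
  assumes "linop f" "hv.subspace V"
  shows "hv.subspace {x \<in> hcarrier. f x \<in> V}"
  by (intro hv.subspaceI)
    (simp_all only: mem_Collect_eq linop_add[OF assms(1)] linop_scale[OF assms(1)] linop_0[OF assms(1)]
      hv.subspace_0[OF assms(2)] hv.subspace_add[OF assms(2)] hv.subspace_scale[OF assms(2)]
      hcarrier_closed)

lemma linop_image_p_space:
  assumes "linop f" "hv.subspace V" "\<And>r k. f (hp r k) \<in> V" "x \<in> p_space"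
  shows "f x \<in> V"
  using p_space_minimal[OF linop_subspace_vimage[OF assms(1,2)]] assms(3,4) by auto

lemma linop_image_s_space:
  assumes "linop f" "hv.subspace V" "\<And>j. f (hs j) \<in> V" "x \<in> s_space"
  shows "f x \<in> V"
  using s_space_minimal[OF linop_subspace_vimage[OF assms(1,2)]] assms(3,4) by auto

lemma linop_eq_s_space:
  assumes "linop f" "linop g" "\<And>j. f (hs j) = g (hs j)" "x \<in> s_space"
  shows "f x = g x"
  by (rule linop_eq_on_span[OF assms(1,2)]) (use assms(3,4) in \<open>auto simp: s_space_def\<close>)

lemma linop_eq_p_space:
  assumes "linop f" "linop g" "\<And>r k. f (hp r k) = g (hp r k)" "x \<in> p_space"
  shows "f x = g x"
  by (rule linop_eq_on_span[OF assms(1,2)]) (use assms(3,4) in \<open>auto simp: p_space_def\<close>)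

text \<open>Identify \<open>a\<^sub>i\<close> with \<open>x\<^sup>i\<close> and \<open>s\<^sub>j\<close> with \<open>-3/8 (x\<^sup>j + x\<^sup>-\<^sup>j - 2)\<close>: the latter turns (H4) into the product of
  Laurent polynomials. Then \<open>tau\<close> re-reads a combination of the \<open>s\<^sub>j\<close> as a combination of the \<open>a\<^sub>i\<close>,
  and \<open>zeta\<close> collects the \<open>z\<close>-terms of its product with \<open>a\<^sub>0\<close>.\<close>

definition tau :: "'a::field hvec \<Rightarrow> 'a hvec" where
  "tau = lext (\<lambda>b. case b of
     HS j \<Rightarrow> vsmul (-(3/8)) (ha (int j) + ha (- int j) - vsmul 2 (ha 0)) | _ \<Rightarrow> 0)"

definition zeta :: "'a::field hvec \<Rightarrow> 'a hvec" where
  "zeta = lext (\<lambda>b. case b of HS j \<Rightarrow> hz 0 j | _ \<Rightarrow> 0)"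

lemma linop_tau [simp]: "linop tau"
  unfolding tau_def by (rule linop_lext) (auto split: hidx.split)

lemma linop_zeta [simp]: "linop zeta"
  unfolding zeta_def by (rule linop_lext) (auto split: hidx.split)

lemmas tau_lin [simp] = linop_closed[OF linop_tau] linop_add[OF linop_tau]
  linop_scale[OF linop_tau] linop_diff[OF linop_tau] linop_0[OF linop_tau] linop_neg[OF linop_tau]

lemmas zeta_lin [simp] = linop_closed[OF linop_zeta] linop_add[OF linop_zeta]
  linop_scale[OF linop_zeta] linop_diff[OF linop_zeta] linop_0[OF linop_zeta] linop_neg[OF linop_zeta]

lemma tau_hs: "tau (hs j) = vsmul (-(3/8)) (ha (int j) + ha (- int j) - vsmul 2 (ha 0))"
proof (cases "j = 0")
  case True
  then show ?thesis by (simp add: coordwise)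
next
  case False
  then show ?thesis unfolding tau_def hs_def by (simp only: lext_vbasis if_False hidx.case)
qed

lemma tau_hs_abs:
  "tau (hs (nat \<bar>i\<bar>)) = vsmul (-(3/8)) (ha i + ha (- i) - vsmul 2 (ha 0))"
  by (cases "i \<ge> 0") (simp_all add: tau_hs add.commute)

lemma zeta_hs: "zeta (hs j) = hz 0 j"
proof (cases "j = 0")
  case False
  then show ?thesis unfolding zeta_def hs_def by (simp only: lext_vbasis if_False hidx.case)
qed simp

lemma zeta_in_p_space [simp]: "x \<in> s_space \<Longrightarrow> zeta x \<in> p_space"
  by (rule linop_image_s_space[where f = zeta]) (simp_all add: zeta_hs)

lemmas linop_intros = linop_plus linop_minus linop_uminus linop_vsmul linop_ident
  linop_compose[OF linop_mult_ha] linop_compose[OF linop_mult_hs]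
  linop_compose[OF linop_tau] linop_compose[OF linop_zeta]

abbreviation A0 :: "'a::field hvec \<Rightarrow> 'a hvec" where "A0 \<equiv> hmult (ha 0)"
abbreviation A1 :: "'a::field hvec \<Rightarrow> 'a hvec" where "A1 \<equiv> hmult (ha 1)"
abbreviation N1 :: "'a::field hvec \<Rightarrow> 'a hvec" where "N1 \<equiv> hmult (hs 1)"
abbreviation N3 :: "'a::field hvec \<Rightarrow> 'a hvec" where "N3 \<equiv> hmult (hs 3)"

lemma sum_zero_solve: "a + b + c = 0 \<Longrightarrow> a = 0 - c - b" for a b c :: "'b::ab_group_add"
proof -
  assume "a + b + c = 0"
  moreover have "a = (a + b + c) - c - b" by simp
  ultimately show ?thesis by simp
qed

text \<open>The part antisymmetric under reversing the sign of the index. Here \<open>A0\<close> is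
  exactly the scalar 1/2, with no correction in \<open>p_space\<close>, as the \<open>hs\<close> and
  \<open>hz\<close> terms cancel in the difference.\<close>

definition d_space :: "'a::field hvec set" where
  "d_space = hv.span (range (\<lambda>j. ha (int j) - ha (- int j)))"

lemma subspace_d_space [simp]: "hv.subspace d_space"
  by (simp add: d_space_def)

lemma delta_in_d_space: "ha (int j) - ha (- int j) \<in> d_space"
  by (auto simp: d_space_def intro!: hv.span_base)

lemma d_space_minimal: "hv.subspace V \<Longrightarrow> (\<And>j. ha (int j) - ha (- int j) \<in> V) \<Longrightarrow> d_space \<subseteq> V"
  unfolding d_space_def by (rule hv.span_minimal) auto

lemma d_space_in_hcarrier [simp]: "x \<in> d_space \<Longrightarrow> x \<in> hcarrier"
  using d_space_minimal[OF subspace_hcarrier] by auto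

text \<open>Modulo the span of the \<open>p\<close>, the vectors \<open>u0 t\<close> and \<open>u2 t\<close> are eigenvectors of \<open>a\<^sub>0\<close> for the
  eigenvalues 0 and 2.\<close>

definition u0 :: "'a::field hvec \<Rightarrow> 'a hvec" where "u0 t = vsmul 2 (tau t) + t"

definition u2 :: "'a::field hvec \<Rightarrow> 'a hvec" where "u2 t = tau t - vsmul (3/2) t"

lemma linop_u0 [simp]: "linop u0" and linop_u2 [simp]: "linop u2"
  unfolding u0_def[abs_def] u2_def[abs_def] by (intro linop_intros)+

text \<open>The product with \<open>s\<^sub>1\<close> acts with opposite signs on the \<open>a\<close>-part and the \<open>s\<close>-part and so does not
  preserve the eigenspaces of \<open>a\<^sub>0\<close>. Modulo the span of the \<open>p\<close>, the operator \<open>Lop\<close> removes the sign, so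
  that \<open>Lop\<^sup>2\<close> and the square of that product agree on elements of weight 0.\<close>

definition Lop :: "'a::field hvec \<Rightarrow> 'a hvec" where
  "Lop x = N1 (A0 x) + A0 (N1 x) - vsmul 2 (N1 x)"

definition Dop :: "'a::field hvec \<Rightarrow> 'a hvec" where
  "Dop x = Lop (Lop x) - N1 (N1 x)"

lemma linop_Lop [simp]: "linop Lop"
  unfolding Lop_def[abs_def] by (intro linop_intros)

lemma linop_Dop [simp]: "linop Dop"
  unfolding Dop_def[abs_def] by (intro linop_intros linop_compose[OF linop_Lop])

section \<open>Polynomials in a linear operator\<close>

text \<open>Horner evaluation at \<open>f\<close>: \<open>ev f v q\<close> is \<open>q(f) v\<close>.\<close>

definition ev :: "('a::field hvec \<Rightarrow> 'a hvec) \<Rightarrow> 'a hvec \<Rightarrow> 'a poly \<Rightarrow> 'a hvec" where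
  "ev f v q = fold_coeffs (\<lambda>a x. vsmul a v + f x) q 0"

lemma ev_0 [simp]: "ev f v 0 = 0"
  by (simp add: ev_def)

lemma ev_pCons: "linop f \<Longrightarrow> ev f v (pCons a q) = vsmul a v + f (ev f v q)"
  unfolding ev_def by (cases "a = 0 \<and> q = 0") (auto simp: linop_0)

lemma ev_in_subspace:
  assumes "linop f" "hv.subspace V" "v \<in> V" "\<And>x. x \<in> V \<Longrightarrow> f x \<in> V"
  shows "ev f v q \<in> V"
  by (induction q) (use assms in \<open>simp_all add: ev_pCons hv.subspace_0 hv.subspace_add hv.subspace_scale\<close>)

context
  fixes f :: "'a::field hvec \<Rightarrow> 'a hvec"
  assumes f: "linop f"
begin

lemma ev_in_hcarrier [simp]: "v \<in> hcarrier \<Longrightarrow> ev f v q \<in> hcarrier"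
  using ev_in_subspace[OF f subspace_hcarrier] linop_closed[OF f] by blast

lemma ev_add: "v \<in> hcarrier \<Longrightarrow> ev f v (p + q) = ev f v p + ev f v q"
  by (induction p q rule: poly_induct2)
    (simp_all add: ev_pCons[OF f] linop_add[OF f] hv.scale_left_distrib ac_simps)

lemma ev_smult: "v \<in> hcarrier \<Longrightarrow> ev f v (smult c p) = vsmul c (ev f v p)"
  by (induction p)
    (simp_all add: ev_pCons[OF f] linop_scale[OF f] hv.scale_right_distrib)

lemma ev_shift: "ev f v (pCons 0 q) = f (ev f v q)"
  by (simp add: ev_pCons[OF f])

lemma ev_one: "ev f v (pCons 1 0) = v"
  by (simp add: ev_pCons[OF f] linop_0[OF f])

text \<open>Commutation is asked on an invariant subspace only: the case in view is
  \<open>hmult (ha i)\<close> against \<open>N3\<close>, established on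
  \<open>p_space\<close>.\<close>

lemma ev_commute:
  assumes g: "linop g" and V: "hv.subspace V" "V \<subseteq> hcarrier" "v \<in> V" "\<And>x. x \<in> V \<Longrightarrow> f x \<in> V"
    and comm: "\<And>x. x \<in> V \<Longrightarrow> g (f x) = f (g x)"
  shows "g (ev f v q) = ev f (g v) q"
proof (induction q)
  case (pCons a q)
  have "ev f v q \<in> V" using ev_in_subspace[OF f V(1,3,4)] .
  with pCons V comm show ?case
    by (simp add: ev_pCons[OF f] linop_add[OF g] linop_scale[OF g] linop_closed[OF f] subset_iff)
qed (simp add: linop_0[OF g])

lemma ev_add_vec: "v \<in> hcarrier \<Longrightarrow> w \<in> hcarrier \<Longrightarrow> ev f (v + w) q = ev f v q + ev f w q"
  by (induction q) (simp_all add: ev_pCons[OF f] linop_add[OF f] hv.scale_right_distrib)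

lemma ev_scale_vec: "v \<in> hcarrier \<Longrightarrow> ev f (vsmul c v) q = vsmul c (ev f v q)"
  by (induction q) (simp_all add: ev_pCons[OF f] linop_scale[OF f] hv.scale_right_distrib mult.commute)

lemma subspace_range_ev: "v \<in> hcarrier \<Longrightarrow> hv.subspace (range (ev f v))"
  by (intro hv.subspaceI)
    (auto simp flip: ev_add ev_smult intro: range_eqI[of _ _ 0] simp del: rangeI)

lemma range_ev_closed: "x \<in> range (ev f v) \<Longrightarrow> f x \<in> range (ev f v)"
  by (auto simp flip: ev_shift)

lemma range_ev_base: "v \<in> range (ev f v)"
  by (rule range_eqI[of _ _ "pCons 1 0"]) (simp add: ev_one)

end

text \<open>Since \<open>\<gamma>\<close> is invertible, the recursion can be solved for
  \<open>x (j + 1)\<close>. The vectors \<open>hs j\<close>, the differences spanning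
  \<open>d_space\<close>, and the \<open>hz 0 (3 * j)\<close> and \<open>hp 0 (3 * j)\<close> obey
  such recursions under \<open>N1\<close> or \<open>N3\<close>.\<close>

lemma recursive_sequence_in_subspace:
  fixes x :: "nat \<Rightarrow> 'a::field hvec"
  assumes V: "hv.subspace V" "\<And>x. x \<in> V \<Longrightarrow> f x \<in> V"
    and x: "x 0 = 0" "x 1 \<in> V"
    and rec: "\<And>j. j > 0 \<Longrightarrow> f (x j) = vsmul \<alpha> (x j) + vsmul \<beta> (x 1) + vsmul \<gamma> (x (j - 1) + x (j + 1))"
    and "\<gamma> \<noteq> 0"
  shows "x j \<in> V"
proof (induction j rule: less_induct)
  case (less j)
  show ?case
  proof (cases "j < 2")
    case True
    then have "j = 0 \<or> j = 1" by linarith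
    with x hv.subspace_0[OF V(1)] show ?thesis by auto
  next
    case False
    then obtain i where i: "j = i + 1" "i > 0"
      by (metis Suc_eq_plus1 gr0I less_2_cases_iff not0_implies_Suc zero_less_Suc One_nat_def)
    then have "x i \<in> V" "x (i - 1) \<in> V" using less by simp_all
    with V x(2) have "vsmul (1 / \<gamma>) (f (x i) - vsmul \<alpha> (x i) - vsmul \<beta> (x 1)) - x (i - 1) \<in> V"
      by (intro hv.subspace_diff hv.subspace_scale) auto
    also have "vsmul (1 / \<gamma>) (f (x i) - vsmul \<alpha> (x i) - vsmul \<beta> (x 1)) - x (i - 1) = x j"
      unfolding rec[OF i(2)] i(1) using \<open>\<gamma> \<noteq> 0\<close> by (simp add: coordwise field_simps)
    finally show ?thesis .
  qed
qed

text \<open>Polynomial coordinates on \<open>s_space\<close>, on \<open>d_space\<close> and on the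
  two eigenspaces of \<open>A0\<close> in \<open>p_space\<close>.\<close>

abbreviation "SS \<equiv> ev N1 (hs 1)"
abbreviation "DD \<equiv> ev N1 (ha 1 - ha (- 1))"
abbreviation "PZ \<equiv> ev N3 (hz 0 3)"
abbreviation "PH \<equiv> ev N3 (hp 0 3)"

section \<open>Ideals of the polynomial ring in one variable\<close>

definition poly_ideal :: "'a::field poly set \<Rightarrow> bool" where
  "poly_ideal K \<longleftrightarrow> 0 \<in> K \<and> (\<forall>p\<in>K. \<forall>q\<in>K. p + q \<in> K) \<and> (\<forall>r. \<forall>p\<in>K. r * p \<in> K)"

text \<open>Multiplication by the variable suffices, by induction on the coefficients of the
  multiplier. For sets defined through \<open>ev f\<close> it amounts to applying
  \<open>f\<close>.\<close>

lemma poly_idealI: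
  assumes "0 \<in> K" "\<And>p q. p \<in> K \<Longrightarrow> q \<in> K \<Longrightarrow> p + q \<in> K"
    "\<And>c p. p \<in> K \<Longrightarrow> smult c p \<in> K" "\<And>p. p \<in> K \<Longrightarrow> pCons 0 p \<in> K"
  shows "poly_ideal K"
proof -
  have "r * p \<in> K" if "p \<in> K" for r p
    by (induction r) (use assms that in \<open>simp_all add: mult_pCons_left\<close>)
  with assms show ?thesis by (simp add: poly_ideal_def)
qed

text \<open>A nonzero element of least degree divides all others by division with remainder; the
  zero ideal has generator 0.\<close>

lemma poly_ideal_principal:
  assumes "poly_ideal K"
  obtains g where "g \<in> K" "\<And>p. p \<in> K \<Longrightarrow> g dvd p"
proof (cases "K \<subseteq> {0}")
  case True
  with assms that[of 0] show ?thesis by (auto simp: poly_ideal_def)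
next
  case False
  then obtain p where "p \<in> K \<and> p \<noteq> 0" by auto
  then obtain g where g: "g \<in> K" "g \<noteq> 0" and min: "\<And>p. p \<in> K \<Longrightarrow> p \<noteq> 0 \<Longrightarrow> degree g \<le> degree p"
    using ex_has_least_nat[of "\<lambda>p. p \<in> K \<and> p \<noteq> 0" p degree] by auto
  have "g dvd p" if "p \<in> K" for p
  proof -
    have "p + - (p div g) * g \<in> K"
      using assms g(1) that unfolding poly_ideal_def by blast
    then have "p mod g \<in> K" by (simp add: minus_div_mult_eq_mod)
    with min degree_mod_less[OF g(2), of p] have "p mod g = 0" by fastforce
    then show ?thesis by (simp add: mod_eq_0_iff_dvd)
  qed
  with g(1) that show ?thesis by blast
qed

lemma dvd_in_poly_ideal: "poly_ideal K \<Longrightarrow> g \<in> K \<Longrightarrow> g dvd p \<Longrightarrow> p \<in> K"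
  unfolding poly_ideal_def by (metis dvdE mult.commute)

section \<open>Elementary facts on ideals\<close>

lemma hideal_subspace: "hideal I \<Longrightarrow> hv.subspace I"
  by (rule hv.subspaceI) (auto simp: hideal_def simp flip: vadd_eq_plus vzero_eq_0)

lemma hideal_in_hcarrier: "hideal I \<Longrightarrow> x \<in> I \<Longrightarrow> x \<in> hcarrier"
  by (auto simp: hideal_def)

lemma hideal_mult: "hideal I \<Longrightarrow> h \<in> hcarrier \<Longrightarrow> x \<in> I \<Longrightarrow> hmult h x \<in> I"
  by (auto simp: hideal_def)

lemma hideal_Int: "hideal I \<Longrightarrow> hideal J \<Longrightarrow> hideal (I \<inter> J)"
  by (auto simp: hideal_def)

text \<open>Only the term \<open>hz i\<close> in the product of \<open>ha i\<close> and
  \<open>ha j\<close> looks asymmetric: it vanishes unless 3 divides \<open>i - j\<close>, and then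
  \<open>i\<close> and \<open>j\<close> have the same residue.\<close>

lemma hbm_commute: "hbm b c = (hbm c b :: 'a::field hvec)"
proof (cases b; cases c)
  fix i j assume "b = HA i" "c = HA j"
  moreover have "hz i (nat \<bar>i - j\<bar>) = (hz j (nat \<bar>i - j\<bar>) :: 'a hvec)"
  proof (cases "3 dvd nat \<bar>i - j\<bar>")
    case True
    then have "i mod 3 = j mod 3"
      unfolding dvd_nat_abs_iff by (simp add: mod_eq_dvd_iff)
    then show ?thesis by (rule hz_cong)
  qed (simp add: hz_def hp_not_dvd)
  ultimately show ?thesis
    by (simp add: pointwise add.commute abs_minus_commute)
qed (simp_all add: pointwise ac_simps abs_minus_commute)

lemma hmult_commute: "hmult x y = hmult y x"
proof
  fix m
  have "hmult x y m = (\<Sum>c\<in>hsupp y. \<Sum>b\<in>hsupp x. x b * y c * hbm b c m)"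
    unfolding hmult_def by (rule sum.swap)
  then show "hmult x y m = hmult y x m"
    unfolding hmult_def by (simp add: hbm_commute[of _ _] mult.commute)
qed

text \<open>Stands in for the image of \<open>I\<close> in the quotient by \<open>p_space\<close>,
  whose preimage it is.\<close>

definition psum :: "'a::field hvec set \<Rightarrow> 'a hvec set" where
  "psum I = {x + p | x p. x \<in> I \<and> p \<in> p_space}"

text \<open>Stability under \<open>A0\<close> separates the eigencomponents; together with
  \<open>N1\<close> it gives stability under \<open>Lop\<close>.\<close>

definition p_space_ideal :: "'a::field hvec set \<Rightarrow> bool" where
  "p_space_ideal Q \<longleftrightarrow> hv.subspace Q \<and> Q \<subseteq> hcarrier \<and> p_space \<subseteq> Q \<and> (\<forall>x\<in>Q. A0 x \<in> Q \<and> N1 x \<in> Q)"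

section \<open>Products and eigenvectors in characteristic different from 2 and 3\<close>

context
  assumes two: "(2::'a::field) \<noteq> 0" and three: "(3::'a) \<noteq> 0"
begin

text \<open>Strips factors 2 from a numeral, so that denominators such as 6, 8 or 16 are recognised
  as nonzero.\<close>

lemma numeral_nonzero [simp]:
  "numeral (num.Bit0 n) = (0 :: 'a) \<longleftrightarrow> numeral n = (0 :: 'a)"
  "(3 :: 'a) \<noteq> 0" "(9 :: 'a) \<noteq> 0"
proof -
  have "(3 :: 'a) * 3 \<noteq> 0" using three by (simp only: mult_eq_0_iff) simp
  then show "(9 :: 'a) \<noteq> 0" by simp
  have "numeral (num.Bit0 n) = 2 * (numeral n :: 'a)"
    by (subst numeral_Bit0) (rule mult_2[symmetric])
  then show "numeral (num.Bit0 n) = (0 :: 'a) \<longleftrightarrow> numeral n = (0 :: 'a)"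
    using two by (metis mult_eq_0_iff)
qed (rule three)

section \<open>Products of spanning vectors, including degenerate indices and residue 0\<close>

lemma mult_ha_hs:
  "hmult (ha i) (hs j :: 'a hvec) = vsmul (-(3/4)) (ha i)
     + vsmul (3/8) (ha (i - int j) + ha (i + int j)) + vsmul (3/2) (hs j) - hz i j"
proof (cases "j = 0")
  case True
  then show ?thesis by (simp add: coordwise field_simps)
next
  case False
  then have "hmult (ha i) (hs j :: 'a hvec) = hbm (HA i) (HS j)"
    by (simp only: ha_def hs_def hmult_vbasis lext_vbasis if_False)
  then show ?thesis by (simp only: hbm.simps pointwise)
qed

lemma mult_hs_ha:
  "hmult (hs j) (ha i :: 'a hvec) = vsmul (-(3/4)) (ha i)
     + vsmul (3/8) (ha (i - int j) + ha (i + int j)) + vsmul (3/2) (hs j) - hz i j" if "j > 0"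
proof -
  from that have "hmult (hs j) (ha i :: 'a hvec) = hbm (HS j) (HA i)"
    by (simp only: ha_def hmult_hs lext_vbasis)
  then show ?thesis by (simp only: hbm.simps pointwise)
qed

lemma mult_hs_hs:
  "hmult (hs j) (hs l :: 'a hvec) = vsmul (3/4) (hs j + hs l)
     - vsmul (3/8) (hs (nat \<bar>int j - int l\<bar>) + hs (j + l))" if "j > 0"
proof (cases "l = 0")
  case True
  then show ?thesis by (simp add: coordwise field_simps)
next
  case False
  then have "hmult (hs j) (hs l :: 'a hvec) = hbm (HS j) (HS l)"
    by (simp only: hmult_hs[OF that]) (simp only: hs_def lext_vbasis if_False)
  then show ?thesis by (simp only: hbm.simps pointwise)
qed

text \<open>Residues 1 and 2 are read off the multiplication table. Residue 0 follows by linearity,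
  because the relation between the three residues persists when each \<open>r\<close> is replaced by
  \<open>-(i + r)\<close>.\<close>

lemma mult_ha_hp:
  "hmult (ha i) (hp r k :: 'a hvec) = vsmul (3/2) (hp r k) - hp (-(i + r)) k"
proof (cases "k > 0 \<and> 3 dvd k")
  case False
  then have "hp r k = (0 :: 'a hvec)" for r by (auto simp: hp_not_dvd)
  then show ?thesis by simp
next
  case True
  then have hp12: "hp 1 k = (vbasis (HP 1 k) :: 'a hvec)" "hp 2 k = (vbasis (HP 2 k) :: 'a hvec)"
    by (simp_all add: hp_def)
  have 1: "hmult (ha i) (hp 1 k :: 'a hvec) = vsmul (3/2) (hp 1 k) - hp (-(i + 1)) k"
    unfolding hp12(1) by (simp only: ha_def hmult_vbasis lext_vbasis hbm.simps pointwise hp12)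
  have 2: "hmult (ha i) (hp 2 k :: 'a hvec) = vsmul (3/2) (hp 2 k) - hp (-(i + 2)) k"
    unfolding hp12(2) by (simp only: ha_def hmult_vbasis lext_vbasis hbm.simps pointwise hp12)
  have sum: "hp (1 + 1) k + hp (1 - 1) k + hp 1 k = (0 :: 'a hvec)" by (rule hp_sum_zero)
  have sum': "hp (- i - 1) k + hp (- i - 2) k + hp (- i) k = (0 :: 'a hvec)"
  proof -
    have "hp (- i - 2) k = (hp (- i + 1) k :: 'a hvec)"
      by (rule hp_cong) presburger
    then show ?thesis using hp_sum_zero[of "- i" k, where 'a = 'a] by (simp add: ac_simps)
  qed
  show ?thesis
  proof (cases r rule: mod3_cases)
    case 1
    have "hp r k = (hp 0 k :: 'a hvec)" "hp (-(i + r)) k = (hp (- i) k :: 'a hvec)"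
      using 1 by (auto intro!: hp_cong) presburger
    moreover have 0: "hp 0 k = 0 - hp 1 k - (hp 2 k :: 'a hvec)"
      using sum by (simp add: algebra_simps add_eq_0_iff)
    moreover have 3: "hp (- i) k = 0 - hp (- i - 1) k - (hp (- i - 2) k :: 'a hvec)"
      using sum' by (metis add_diff_cancel_left' diff_diff_eq)
    ultimately show ?thesis
      by (simp add: \<open>hmult (ha i) (hp 1 k) = _\<close> \<open>hmult (ha i) (hp 2 k) = _\<close>)
         (simp add: coordwise field_simps)
  next
    case 2
    then have "hp r k = (hp 1 k :: 'a hvec)" "hp (-(i + r)) k = (hp (-(i + 1)) k :: 'a hvec)"
      by (auto intro!: hp_cong) presburger
    then show ?thesis using 1 by simp
  next
    case 3
    then have "hp r k = (hp 2 k :: 'a hvec)" "hp (-(i + r)) k = (hp (-(i + 2)) k :: 'a hvec)"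
      by (auto intro!: hp_cong) presburger
    then show ?thesis using 2 by simp
  qed
qed

text \<open>Without \<open>3 dvd k\<close> the left side is 0, while for \<open>j = 3\<close> the
  right side is a nonzero multiple of \<open>hp r 3\<close>.\<close>

lemma mult_hs_hp:
  assumes "j > 0" "3 dvd k"
  shows "hmult (hs j) (hp r k :: 'a hvec) = vsmul (3/4) (hp r j + hp r k)
     - vsmul (3/8) (hp r (nat \<bar>int j - int k\<bar>) + hp r (j + k))"
proof (cases "k = 0")
  case True
  then show ?thesis by (simp add: coordwise field_simps)
next
  case False
  with assms have hp12: "hp 1 k = (vbasis (HP 1 k) :: 'a hvec)" "hp 2 k = (vbasis (HP 2 k) :: 'a hvec)"
    by (simp_all add: hp_def)
  have 1: "hmult (hs j) (hp 1 k :: 'a hvec) = vsmul (3/4) (hp 1 j + hp 1 k)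
     - vsmul (3/8) (hp 1 (nat \<bar>int j - int k\<bar>) + hp 1 (j + k))"
    unfolding hp12(1) by (simp only: hmult_hs[OF assms(1)] lext_vbasis hbm.simps pointwise hp12)
  have 2: "hmult (hs j) (hp 2 k :: 'a hvec) = vsmul (3/4) (hp 2 j + hp 2 k)
     - vsmul (3/8) (hp 2 (nat \<bar>int j - int k\<bar>) + hp 2 (j + k))"
    unfolding hp12(2) by (simp only: hmult_hs[OF assms(1)] lext_vbasis hbm.simps pointwise hp12)
  have 0: "hp 0 l = 0 - hp 1 l - (hp 2 l :: 'a hvec)" for l
    using hp_sum_zero[of 1 l, where 'a = 'a] by (simp add: algebra_simps add_eq_0_iff)
  show ?thesis
  proof (cases r rule: mod3_cases)
    case 1
    then have "hp r l = (hp 0 l :: 'a hvec)" for l by (auto intro!: hp_cong)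
    then show ?thesis
      by (simp add: 0 \<open>hmult (hs j) (hp 1 k) = _\<close> \<open>hmult (hs j) (hp 2 k) = _\<close>)
         (simp add: coordwise field_simps)
  next
    case 2
    then have "hp r l = (hp 1 l :: 'a hvec)" for l by (auto intro!: hp_cong)
    then show ?thesis using 1 by simp
  next
    case 3
    then have "hp r l = (hp 2 l :: 'a hvec)" for l by (auto intro!: hp_cong)
    then show ?thesis using 2 by simp
  qed
qed

lemmas basis_products = mult_ha_ha mult_ha_hs mult_hs_ha mult_hs_hs mult_ha_hp mult_hs_hp

section \<open>The operators \<open>N1\<close>, \<open>A0\<close> and \<open>A1\<close> on the
  spanning vectors\<close>

lemma hz_not_dvd: "\<not> 3 dvd k \<Longrightarrow> hz r k = 0"
  by (simp add: hz_def hp_not_dvd vsub_eq_minus)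

lemma N1_hs: "N1 (hs j :: 'a hvec) = vsmul (3/4) (hs 1 + hs j)
     - vsmul (3/8) (hs (nat \<bar>1 - int j\<bar>) + hs (1 + j))"
  by (simp add: basis_products)

lemma N1_ha: "N1 (ha i :: 'a hvec) = vsmul (-(3/4)) (ha i)
     + vsmul (3/8) (ha (i - 1) + ha (i + 1)) + vsmul (3/2) (hs 1)"
  by (simp add: basis_products hz_not_dvd)

text \<open>For \<open>3 dvd k\<close> none of 1, \<open>k - 1\<close> and \<open>k + 1\<close> is
  divisible by 3, so the other terms vanish. As \<open>N1\<close> is only a scalar on
  \<open>p_space\<close>, polynomials in \<open>N3\<close> take over there.\<close>

lemma N1_hp: "N1 (hp r k :: 'a hvec) = vsmul (3/4) (hp r k)"
proof (cases "3 dvd k")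
  case True
  have "\<not> 3 dvd nat \<bar>1 - int k\<bar>"
    unfolding dvd_nat_abs_iff using True by presburger
  moreover have "\<not> 3 dvd 1 + k"
    using True by presburger
  ultimately show ?thesis using True by (simp add: basis_products hp_not_dvd)
qed (simp add: hp_not_dvd)

lemma N1_p_space: "p \<in> p_space \<Longrightarrow> N1 p = vsmul (3/4) (p :: 'a hvec)"
  by (rule linop_eq_p_space[where f = N1], intro linop_intros, intro linop_intros) (simp_all add: N1_hp)

lemma ha_p_space: "p \<in> p_space \<Longrightarrow> hmult (ha i) p \<in> (p_space :: 'a hvec set)"
  by (rule linop_image_p_space[where f = "hmult (ha i)"]) (auto simp: basis_products p_space_closed)

lemma N1_s_space [simp]: "t \<in> s_space \<Longrightarrow> N1 t \<in> (s_space :: 'a hvec set)"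
  by (rule linop_image_s_space[where f = N1])
    (simp_all add: N1_hs hv.subspace_diff hv.subspace_add hv.subspace_scale)

text \<open>Read \<open>ha i\<close> as the power x^i. On weight 0, where the \<open>hs 1\<close>
  terms cancel, \<open>N1\<close> multiplies by 3/8 (x + 1/x - 2); on \<open>s_space\<close>,
  identified through \<open>tau\<close>, it multiplies by the negative of this.\<close>

lemma N1_tau: "t \<in> s_space \<Longrightarrow> N1 (tau t) = - tau (N1 t :: 'a hvec)"
proof (rule linop_eq_s_space[where f = "\<lambda>t. N1 (tau t)"])
  fix j show "N1 (tau (hs j)) = - tau (N1 (hs j) :: 'a hvec)"
  proof (cases "j = 0")
    case False
    then obtain l where l: "j = Suc l" by (auto dest: gr0_implies_Suc)
    have "- 2 - int l = - int l - 2" "- 1 - int l = - int l - 1" "int l - 1 + 1 = int l" by simp_all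
    with l show ?thesis
      by (simp add: N1_hs tau_hs N1_ha) (simp add: coordwise field_simps)
  qed simp
qed (assumption | intro linop_intros)+

text \<open>Together with \<open>A0_tau\<close>: modulo \<open>p_space\<close>, \<open>A0\<close>
  acts on the pair \<open>tau t\<close>, \<open>t\<close> by a constant matrix of trace 2 and
  determinant 0, whence the eigenvalues 0 and 2.\<close>

lemma A0_s_space: "t \<in> s_space \<Longrightarrow> A0 t = vsmul (3/2) t - tau t - zeta (t :: 'a hvec)"
proof (rule linop_eq_s_space[where f = "A0"])
  fix j show "A0 (hs j) = vsmul (3/2) (hs j) - tau (hs j) - zeta (hs j :: 'a hvec)"
    by (simp add: basis_products tau_hs zeta_hs) (simp add: coordwise field_simps)
qed (assumption | intro linop_intros)+

lemma A0_tau: "t \<in> s_space \<Longrightarrow> A0 (tau t) = vsmul (1/2) (tau t) - vsmul (3/4) t - vsmul (3/4) (zeta (t :: 'a hvec))"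
proof (rule linop_eq_s_space[where f = "\<lambda>t. A0 (tau t)"])
  fix j show "A0 (tau (hs j)) = vsmul (1/2) (tau (hs j)) - vsmul (3/4) (hs j) - vsmul (3/4) (zeta (hs j :: 'a hvec))"
    by (simp add: basis_products tau_hs zeta_hs) (simp add: coordwise field_simps)
qed (assumption | intro linop_intros)+

text \<open>On \<open>p_space\<close>, \<open>A0\<close> is 3/2 minus the reflection exchanging
  residues 1 and 2. The vector \<open>hz 0 k\<close> is odd and \<open>hp 0 k\<close> even under it,
  which gives 5/2 here and 1/2 in \<open>A0_hp0\<close>.\<close>

lemma A0_hz: "A0 (hz 0 k :: 'a hvec) = vsmul (5/2) (hz 0 k)"
proof -
  have "hp (- 1) k = (hp 2 k :: 'a hvec)" "hp (- 2) k = (hp 1 k :: 'a hvec)"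
    by (rule hp_cong, simp)+
  then show ?thesis by (simp add: hz_def vsub_eq_minus basis_products coordwise field_simps)
qed

lemma A0_hp0: "A0 (hp 0 k :: 'a hvec) = vsmul (1/2) (hp 0 k)"
  by (simp add: basis_products coordwise field_simps)

text \<open>The mixed terms here and in \<open>A1_hz\<close> let an ideal pass between the two
  eigenspaces of \<open>A0\<close> in \<open>p_space\<close>.\<close>

lemma A1_hp0: "A1 (hp 0 k :: 'a hvec) = vsmul 2 (hp 0 k) + vsmul (1/2) (hz 0 k)"
proof -
  have h: "hp 1 k = 0 - hp 0 k - (hp (-1) k :: 'a hvec)"
    by (rule sum_zero_solve) (use hp_sum_zero[of 0 k, where 'a = 'a] in simp)
  then show ?thesis by (simp add: hz_def vsub_eq_minus basis_products h) (simp add: coordwise field_simps)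
qed

lemma A1_hz: "A1 (hz 0 k :: 'a hvec) = hz 0 k + vsmul (3/2) (hp 0 k)"
proof -
  have h: "hp 1 k = 0 - hp 0 k - (hp (-1) k :: 'a hvec)"
    by (rule sum_zero_solve) (use hp_sum_zero[of 0 k, where 'a = 'a] in simp)
  have "hp (- 2) k = (hp 1 k :: 'a hvec)"
    by (rule hp_cong) simp
  then show ?thesis
    by (simp add: hz_def vsub_eq_minus basis_products) (simp add: h coordwise field_simps)
qed

lemma A0_delta:
  "A0 (ha i - ha (- i) :: 'a hvec) = vsmul (1/2) (ha i - ha (- i))"
  by (simp add: basis_products coordwise field_simps)

section \<open>The components as modules over polynomials in one operator\<close>

lemma s_space_eq_ev:
  assumes "t \<in> (s_space :: 'a hvec set)"
  obtains q where "t = SS q"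
proof -
  have V: "hv.subspace (range (SS :: 'a poly \<Rightarrow> 'a hvec))" by (simp add: subspace_range_ev)
  have "hs j \<in> range (SS :: 'a poly \<Rightarrow> 'a hvec)" for j
  proof (rule recursive_sequence_in_subspace[OF V range_ev_closed[OF linop_mult_hs],
        where \<alpha> = "3/4" and \<beta> = "3/4" and \<gamma> = "-(3/8)"])
    fix j :: nat assume "j > 0"
    then obtain i where "j = Suc i" by (auto dest: gr0_implies_Suc)
    then show "N1 (hs j) = vsmul (3/4) (hs j) + vsmul (3/4) (hs 1)
        + vsmul (-(3/8)) (hs (j - 1) + hs (j + 1) :: 'a hvec)"
      by (simp add: N1_hs) (simp add: coordwise field_simps)
  qed (simp_all add: range_ev_base)
  from s_space_minimal[OF V this] assms that show ?thesis by blast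
qed

lemma SS_in_s_space [simp]: "SS q \<in> (s_space :: 'a hvec set)"
  by (rule ev_in_subspace) simp_all

text \<open>The recursion comes from \<open>N1_ha\<close>; its \<open>\<beta>\<close> is 0 because
  the \<open>hs 1\<close> terms cancel in the difference.\<close>

lemma d_space_eq_ev:
  assumes "d \<in> (d_space :: 'a hvec set)"
  obtains q where "d = DD q"
proof -
  have V: "hv.subspace (range (DD :: 'a poly \<Rightarrow> 'a hvec))" by (simp add: subspace_range_ev)
  have "ha (int j) - ha (- int j) \<in> range (DD :: 'a poly \<Rightarrow> 'a hvec)" for j
  proof (rule recursive_sequence_in_subspace[OF V range_ev_closed[OF linop_mult_hs],
        where \<alpha> = "-(3/4)" and \<beta> = 0 and \<gamma> = "3/8" and x = "\<lambda>j. ha (int j) - ha (- int j)"])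
    fix j :: nat assume "j > 0"
    then obtain i where "j = Suc i" by (auto dest: gr0_implies_Suc)
    moreover have "- 1 - int i = - int i - 1" "- 2 - int i = - int i - 2" by simp_all
    ultimately show "N1 (ha (int j) - ha (- int j)) = vsmul (-(3/4)) (ha (int j) - ha (- int j))
        + vsmul 0 (ha (int 1) - ha (- int 1)) + vsmul (3/8) (ha (int (j - 1)) - ha (- int (j - 1))
          + (ha (int (j + 1)) - ha (- int (j + 1))) :: 'a hvec)"
      by (simp add: N1_ha) (simp add: coordwise field_simps)
  qed (simp_all add: range_ev_base)
  from d_space_minimal[OF V this] assms that show ?thesis by blast
qed

lemma N1_d_space [simp]: "d \<in> d_space \<Longrightarrow> N1 d \<in> (d_space :: 'a hvec set)"
proof -
  have "N1 (ha (int j) - ha (- int j)) \<in> (d_space :: 'a hvec set)" for j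
  proof (cases "j = 0")
    case False
    then obtain i where "j = Suc i" by (auto dest: gr0_implies_Suc)
    moreover have "- 1 - int i = - int i - 1" "- 2 - int i = - int i - 2" by simp_all
    ultimately have "N1 (ha (int j) - ha (- int j)) = vsmul (-(3/4)) (ha (int j) - ha (- int j))
        + vsmul (3/8) (ha (int (j - 1)) - ha (- int (j - 1))
          + (ha (int (j + 1)) - ha (- int (j + 1))) :: 'a hvec)"
      by (simp add: N1_ha) (simp add: coordwise field_simps)
    then show ?thesis
      by (simp only: hv.subspace_add hv.subspace_scale subspace_d_space delta_in_d_space)
  qed (simp add: hv.subspace_0)
  then show "d \<in> d_space \<Longrightarrow> N1 d \<in> (d_space :: 'a hvec set)"
    using d_space_minimal[OF linop_subspace_vimage[OF linop_mult_hs subspace_d_space]] by auto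
qed

lemma DD_in_d_space [simp]: "DD q \<in> (d_space :: 'a hvec set)"
  using delta_in_d_space[of 1, where 'a = 'a] by (intro ev_in_subspace) simp_all

lemma A0_d_space: "d \<in> d_space \<Longrightarrow> A0 d = vsmul (1/2) (d :: 'a hvec)"
  unfolding d_space_def
  by (rule linop_eq_on_span[where f = A0], intro linop_intros, intro linop_intros)
    (auto simp: A0_delta simp del: mult_ha)

lemma N3_hp:
  "N3 (hp r (3 * j) :: 'a hvec) = vsmul (3/4) (hp r 3 + hp r (3 * j))
     - vsmul (3/8) (hp r (3 * (j - 1)) + hp r (3 * (j + 1)))" if "j > 0"
proof -
  from that obtain i where "j = Suc i" by (auto dest: gr0_implies_Suc)
  moreover have "nat (3 * int i) = 3 * i" by simp
  ultimately show ?thesis by (simp add: basis_products)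
qed

lemma N3_hz:
  "N3 (hz r (3 * j) :: 'a hvec) = vsmul (3/4) (hz r 3 + hz r (3 * j))
     - vsmul (3/8) (hz r (3 * (j - 1)) + hz r (3 * (j + 1)))" if "j > 0"
  unfolding hz_def vsub_eq_minus using that
  by (simp only: mult_hs hp_in_hcarrier N3_hp) (simp add: coordwise field_simps)

lemma N3_p_space [simp]: "p \<in> p_space \<Longrightarrow> N3 p \<in> (p_space :: 'a hvec set)"
proof (rule linop_image_p_space[where f = N3])
  fix r k show "N3 (hp r k) \<in> (p_space :: 'a hvec set)"
    by (cases "3 dvd k") (simp_all add: basis_products hp_not_dvd p_space_closed)
qed simp_all

lemma ev_N3_in_p_space [simp]: "v \<in> p_space \<Longrightarrow> ev N3 v q \<in> (p_space :: 'a hvec set)"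
  by (rule ev_in_subspace) simp_all

text \<open>Two generators suffice: \<open>hp 1 k\<close> and \<open>hp (-1) k\<close> are half of
  \<open>hz 0 k - hp 0 k\<close> and of \<open>- hz 0 k - hp 0 k\<close>.\<close>

lemma p_space_eq_ev:
  assumes "p \<in> (p_space :: 'a hvec set)"
  obtains q r where "p = PZ q + PH r"
proof -
  define V where "V = {x + y | x y. x \<in> range (PZ :: 'a poly \<Rightarrow> 'a hvec) \<and> y \<in> range (PH :: 'a poly \<Rightarrow> 'a hvec)}"
  have VZ: "hv.subspace (range (PZ :: 'a poly \<Rightarrow> 'a hvec))"
    and VH: "hv.subspace (range (PH :: 'a poly \<Rightarrow> 'a hvec))"
    by (simp_all add: subspace_range_ev)
  then have V: "hv.subspace V"
    unfolding V_def by (rule hv.subspace_sums)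
  have Z: "hz 0 (3 * j) \<in> range (PZ :: 'a poly \<Rightarrow> 'a hvec)" for j
  proof (rule recursive_sequence_in_subspace[OF VZ range_ev_closed[OF linop_mult_hs],
        where \<alpha> = "3/4" and \<beta> = "3/4" and \<gamma> = "-(3/8)" and x = "\<lambda>j. hz 0 (3 * j)"])
    fix j :: nat assume "j > 0"
    show "N3 (hz 0 (3 * j)) = vsmul (3/4) (hz 0 (3 * j)) + vsmul (3/4) (hz 0 (3 * 1))
        + vsmul (-(3/8)) (hz 0 (3 * (j - 1)) + hz 0 (3 * (j + 1)) :: 'a hvec)"
      unfolding N3_hz[OF \<open>j > 0\<close>] by (simp add: coordwise field_simps)
  qed (simp_all add: range_ev_base)
  have H: "hp 0 (3 * j) \<in> range (PH :: 'a poly \<Rightarrow> 'a hvec)" for j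
  proof (rule recursive_sequence_in_subspace[OF VH range_ev_closed[OF linop_mult_hs],
        where \<alpha> = "3/4" and \<beta> = "3/4" and \<gamma> = "-(3/8)" and x = "\<lambda>j. hp 0 (3 * j)"])
    fix j :: nat assume "j > 0"
    show "N3 (hp 0 (3 * j)) = vsmul (3/4) (hp 0 (3 * j)) + vsmul (3/4) (hp 0 (3 * 1))
        + vsmul (-(3/8)) (hp 0 (3 * (j - 1)) + hp 0 (3 * (j + 1)) :: 'a hvec)"
      unfolding N3_hp[OF \<open>j > 0\<close>] by (simp add: coordwise field_simps)
  qed (simp_all add: range_ev_base)
  have comb: "vsmul a (hz 0 (3 * j)) + vsmul b (hp 0 (3 * j)) \<in> V" for a b j
    unfolding V_def using hv.subspace_scale[OF VZ Z] hv.subspace_scale[OF VH H] by blast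
  have "hp r k \<in> V" for r k
  proof (cases "3 dvd k")
    case False
    then show ?thesis using hv.subspace_0[OF V] by (simp add: hp_not_dvd)
  next
    case True
    then obtain j where k: "k = 3 * j" by auto
    have s: "hp 1 k = 0 - hp 0 k - (hp (-1) k :: 'a hvec)"
      by (rule sum_zero_solve) (use hp_sum_zero[of 0 k, where 'a = 'a] in simp)
    show ?thesis
    proof (cases r rule: mod3_cases)
      case 1
      have "hp r k = vsmul 0 (hz 0 k) + (vsmul 1 (hp 0 k) :: 'a hvec)"
        using 1 by (simp add: coordwise) (metis hp_cong mod_0)
      with comb show ?thesis unfolding k by (simp only:)
    next
      case 2
      then have "hp r k = (hp 1 k :: 'a hvec)" by (intro hp_cong) simp
      then have "hp r k = vsmul (1/2) (hz 0 k) + (vsmul (-(1/2)) (hp 0 k) :: 'a hvec)"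
        by (simp add: hz_def vsub_eq_minus) (simp add: s coordwise field_simps)
      with comb show ?thesis unfolding k by (simp only:)
    next
      case 3
      then have "hp r k = (hp (-1) k :: 'a hvec)" by (intro hp_cong) simp
      then have "hp r k = vsmul (-(1/2)) (hz 0 k) + (vsmul (-(1/2)) (hp 0 k) :: 'a hvec)"
        by (simp add: hz_def vsub_eq_minus) (simp add: s coordwise field_simps)
      with comb show ?thesis unfolding k by (simp only:)
    qed
  qed
  from p_space_minimal[OF V this] assms that show ?thesis by (auto simp: V_def)
qed

text \<open>On \<open>hp r k\<close>, \<open>ha i\<close> acts through the residue and
  \<open>N3\<close> through the second index.\<close>

lemma ha_N3_p_space: "p \<in> p_space \<Longrightarrow> hmult (ha i) (N3 p) = N3 (hmult (ha i) (p :: 'a hvec))"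
proof (rule linop_eq_p_space[where f = "\<lambda>p. hmult (ha i) (N3 p)"])
  fix r k show "hmult (ha i) (N3 (hp r k)) = N3 (hmult (ha i) (hp r k :: 'a hvec))"
    by (cases "3 dvd k") (simp_all add: basis_products hp_not_dvd, simp_all add: coordwise field_simps)
qed (assumption | intro linop_intros)+

lemma ha_ev_N3:
  "v \<in> p_space \<Longrightarrow> hmult (ha i) (ev N3 v q) = ev N3 (hmult (ha i) (v :: 'a hvec)) q"
  by (rule ev_commute[of _ _ p_space]) (auto simp: ha_N3_p_space)

lemma A_PZ_PH:
  "A0 (PZ q) = vsmul (5/2) (PZ q :: 'a hvec)" "A0 (PH q) = vsmul (1/2) (PH q :: 'a hvec)"
  "A1 (PZ q) = PZ q + vsmul (3/2) (PH q :: 'a hvec)"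
  "A1 (PH q) = vsmul 2 (PH q) + vsmul (1/2) (PZ q :: 'a hvec)"
  by (simp_all add: ha_ev_N3 A0_hz A0_hp0 A1_hz A1_hp0 ev_scale_vec ev_add_vec)

section \<open>The operators \<open>Lop\<close> and \<open>Dop\<close> on the
  eigencomponents\<close>

lemma A0_u0: "t \<in> s_space \<Longrightarrow> A0 (u0 t) = vsmul (-(5/2)) (zeta (t :: 'a hvec))"
  by (simp add: u0_def A0_s_space A0_tau) (simp add: coordwise field_simps)

lemma A0_u2: "t \<in> s_space \<Longrightarrow> A0 (u2 t) = vsmul 2 (u2 t) + vsmul (3/4) (zeta (t :: 'a hvec))"
  by (simp add: u2_def A0_s_space A0_tau) (simp add: coordwise field_simps)

lemma N1_N1_u0: "t \<in> s_space \<Longrightarrow> N1 (N1 (u0 t)) = u0 (N1 (N1 (t :: 'a hvec)))"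
  by (simp add: u0_def N1_tau)

lemma N1_N1_u2: "t \<in> s_space \<Longrightarrow> N1 (N1 (u2 t)) = u2 (N1 (N1 (t :: 'a hvec)))"
  by (simp add: u2_def N1_tau)

lemma N1_zeta: "t \<in> s_space \<Longrightarrow> N1 (zeta t) = vsmul (3/4) (zeta (t :: 'a hvec))"
  by (simp add: N1_p_space)

text \<open>In the anticommutator of \<open>A0\<close> and \<open>N1\<close> the terms exchanging
  \<open>tau t\<close> and \<open>t\<close> cancel, and subtracting \<open>vsmul 2 (N1 x)\<close>
  makes the two diagonal entries equal.\<close>

lemma Lop_u0:
  assumes "t \<in> (s_space :: 'a hvec set)"
  shows "Lop (u0 t) = u0 (N1 t) + (vsmul (1/2) (zeta (N1 t)) - vsmul (15/8) (zeta t))"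
  using assms unfolding Lop_def
  by (simp add: A0_u0) (simp add: u0_def A0_s_space A0_tau N1_tau N1_zeta, simp add: coordwise field_simps)

lemma Lop_u2:
  assumes "t \<in> (s_space :: 'a hvec set)"
  shows "Lop (u2 t) = u2 (N1 t) + (vsmul (9/4) (zeta (N1 t)) + vsmul (9/16) (zeta t))"
  using assms unfolding Lop_def
  by (simp add: u2_def A0_s_space A0_tau N1_tau N1_zeta) (simp add: coordwise field_simps)

lemma Lop_p_space_eq: "p \<in> p_space \<Longrightarrow> Lop p = vsmul (3/2) (A0 p - (p :: 'a hvec))"
  by (simp add: Lop_def N1_p_space ha_p_space) (simp add: coordwise field_simps)

lemma Lop_p_space: "p \<in> p_space \<Longrightarrow> Lop p \<in> (p_space :: 'a hvec set)"
  by (simp add: Lop_p_space_eq ha_p_space p_space_closed)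

lemma Lop_d_space: "d \<in> d_space \<Longrightarrow> Lop d = vsmul (-1) (N1 (d :: 'a hvec))"
  by (simp add: Lop_def A0_d_space) (simp add: coordwise field_simps)

text \<open>Modulo \<open>p_space\<close> both squares replace \<open>t\<close> by
  \<open>N1 (N1 t)\<close>: the sign in \<open>N1_tau\<close> disappears on squaring.\<close>

lemma Dop_u:
  assumes "t \<in> (s_space :: 'a hvec set)"
  shows "Dop (u0 t) \<in> p_space" "Dop (u2 t) \<in> p_space"
  using assms
  by (simp_all add: Dop_def Lop_u0 Lop_u2 linop_add[OF linop_Lop] linop_closed[OF linop_u0]
      linop_closed[OF linop_u2] N1_N1_u0 N1_N1_u2 Lop_p_space p_space_closed)

lemma Dop_d_space: "d \<in> d_space \<Longrightarrow> Dop d = (0 :: 'a hvec)"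
  by (simp add: Dop_def Lop_d_space linop_scale[OF linop_Lop] linop_neg[OF linop_Lop])

text \<open>\<open>Lop\<close> is 9/4 and \<open>N1\<close> is 3/4 here, and 81/16 - 9/16 = 9/2 is
  invertible.\<close>

lemma Dop_PZ: "Dop (PZ q) = vsmul (9/2) (PZ q :: 'a hvec)"
proof -
  have "Lop (PZ q) = vsmul (9/4) (PZ q :: 'a hvec)"
    by (simp add: Lop_p_space_eq A_PZ_PH) (simp add: coordwise field_simps)
  then show ?thesis
    by (simp add: Dop_def linop_scale[OF linop_Lop] N1_p_space)
      (simp add: coordwise field_simps)
qed

section \<open>Ideals containing an element of nonzero weight\<close>

text \<open>The scalar \<open>\<alpha>\<close> is the weight of \<open>x\<close>, all other summands
  having weight 0.\<close>

lemma hcarrier_decomp: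
  assumes "x \<in> (hcarrier :: 'a hvec set)"
  obtains \<alpha> t t' d p where "t \<in> s_space" "t' \<in> s_space" "d \<in> d_space" "p \<in> p_space"
    "x = vsmul \<alpha> (ha 0) + u0 t + u2 t' + d + p"
proof -
  define W :: "'a hvec set" where "W = {x. \<exists>\<alpha> t t' d p. t \<in> s_space \<and> t' \<in> s_space \<and> d \<in> d_space \<and> p \<in> p_space
    \<and> x = vsmul \<alpha> (ha 0) + u0 t + u2 t' + d + p}"
  have WI: "x \<in> W" if "t \<in> s_space" "t' \<in> s_space" "d \<in> d_space" "p \<in> p_space"
    "x = vsmul \<alpha> (ha 0) + u0 t + u2 t' + d + p" for x \<alpha> t t' d p
    using that unfolding W_def by blast
  have W: "hv.subspace W"
  proof (rule hv.subspaceI)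
    show "0 \<in> W"
      by (rule WI[of 0 0 0 0 _ 0])
        (simp_all add: hv.subspace_0 linop_0[OF linop_u0] linop_0[OF linop_u2])
  next
    fix x y :: "'a hvec" and c :: 'a
    assume "x \<in> W"
    then obtain \<alpha> t t' d p where x: "t \<in> s_space" "t' \<in> s_space" "d \<in> d_space" "p \<in> p_space"
      "x = vsmul \<alpha> (ha 0) + u0 t + u2 t' + d + p" unfolding W_def by blast
    show "vsmul c x \<in> W"
      by (rule WI[of "vsmul c t" "vsmul c t'" "vsmul c d" "vsmul c p" _ "c * \<alpha>"])
        (use x in \<open>simp_all add: hv.subspace_scale linop_scale[OF linop_u0] linop_scale[OF linop_u2]
          hv.scale_right_distrib\<close>)
    assume "y \<in> W"
    then obtain \<beta> s s' e q where y: "s \<in> s_space" "s' \<in> s_space" "e \<in> d_space" "q \<in> p_space"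
      "y = vsmul \<beta> (ha 0) + u0 s + u2 s' + e + q" unfolding W_def by blast
    show "x + y \<in> W"
      by (rule WI[of "t + s" "t' + s'" "d + e" "p + q" _ "\<alpha> + \<beta>"])
        (use x y in \<open>simp_all add: hv.subspace_add linop_add[OF linop_u0] linop_add[OF linop_u2]
          hv.scale_left_distrib ac_simps\<close>)
  qed
  have "ha i \<in> W" for i
  proof -
    have "ha i - ha (- i) \<in> (d_space :: 'a hvec set)"
    proof (cases "i \<ge> 0")
      case True
      then show ?thesis using delta_in_d_space[of "nat i", where 'a = 'a] by simp
    next
      case False
      then have "- (ha i - ha (- i)) \<in> (d_space :: 'a hvec set)"
        using delta_in_d_space[of "nat (- i)", where 'a = 'a] by simp
      from hv.subspace_neg[OF subspace_d_space this] show ?thesis by simp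
    qed
    \<comment> \<open>\<open>ha i\<close> is \<open>ha 0\<close> plus half its antisymmetric part
      plus -4/3 times \<open>tau (hs (nat \<bar>i\<bar>))\<close>; the coefficients -1/2 and -1/3
      express this last multiple through \<open>u0\<close> and \<open>u2\<close>.\<close>
    then show ?thesis
      by (intro WI[of "vsmul (-(1/2)) (hs (nat \<bar>i\<bar>))" "vsmul (-(1/3)) (hs (nat \<bar>i\<bar>))"
            "vsmul (1/2) (ha i - ha (- i))" 0 _ 1])
        (simp_all only: hv.subspace_scale subspace_s_space hs_in_s_space subspace_d_space p_space_closed u0_def u2_def
          tau_lin hcarrier_closed hs_in_hcarrier tau_hs_abs,
         simp add: coordwise field_simps)
  qed
  moreover have "hs j \<in> W" for j
    by (rule WI[of "vsmul (1/4) (hs j)" "vsmul (-(1/2)) (hs j)" 0 0 _ 0])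
      (simp_all only: hv.subspace_scale subspace_s_space hs_in_s_space hv.subspace_0 subspace_d_space p_space_closed
        u0_def u2_def tau_lin hcarrier_closed hs_in_hcarrier, simp add: coordwise field_simps)
  moreover have "hp r k \<in> W" for r k
    by (rule WI[of 0 0 0 "hp r k" _ 0])
      (simp_all add: hv.subspace_0 linop_0[OF linop_u0] linop_0[OF linop_u2])
  ultimately have "x \<in> W" using hcarrier_subset[OF W] assms by blast
  then show thesis using that unfolding W_def by blast
qed

text \<open>The eigenvalues 5/2 and 1/2 of \<open>A0\<close> differ by 2, so half of
  \<open>A0\<close> minus 1/2 projects onto the first summand.\<close>

lemma hideal_p_space_split:
  assumes I: "hideal I" and mem: "PZ q + PH r \<in> (I :: 'a hvec set)"
  shows "PZ q \<in> I" "PH r \<in> I"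
proof -
  note sub = hideal_subspace[OF I]
  have "vsmul (1/2) (A0 (PZ q + PH r) - vsmul (1/2) (PZ q + PH r)) \<in> I"
    by (intro hv.subspace_scale hv.subspace_diff sub hideal_mult[OF I] mem ha_in_hcarrier)
  also have "vsmul (1/2) (A0 (PZ q + PH r) - vsmul (1/2) (PZ q + PH r)) = PZ q"
    by (simp add: A_PZ_PH) (simp add: coordwise field_simps)
  finally show Z: "PZ q \<in> I" .
  from hv.subspace_diff[OF sub mem this] show "PH r \<in> I" by simp
qed

text \<open>Hence a single polynomial ideal describes the intersection of \<open>I\<close> with
  \<open>p_space\<close>.\<close>

lemma hideal_PZ_iff_PH:
  assumes I: "hideal (I :: 'a hvec set)"
  shows "PZ q \<in> I \<longleftrightarrow> PH q \<in> I"
proof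
  note sub = hideal_subspace[OF I]
  assume mem: "PZ q \<in> I"
  have "vsmul (2/3) (A1 (PZ q) - PZ q) \<in> I"
    by (intro hv.subspace_scale hv.subspace_diff sub hideal_mult[OF I] mem ha_in_hcarrier)
  then show "PH q \<in> I" by (simp add: A_PZ_PH)
next
  note sub = hideal_subspace[OF I]
  assume mem: "PH q \<in> I"
  have "vsmul 2 (A1 (PH q) - vsmul 2 (PH q)) \<in> I"
    by (intro hv.subspace_scale hv.subspace_diff sub hideal_mult[OF I] mem ha_in_hcarrier)
  then show "PZ q \<in> I" by (simp add: A_PZ_PH)
qed

lemma poly_ideal_PZ:
  assumes I: "hideal (I :: 'a hvec set)"
  shows "poly_ideal {q. PZ q \<in> I}"
  using hideal_subspace[OF I] hideal_mult[OF I]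
  by (intro poly_idealI) (simp_all add: ev_add ev_smult ev_shift hv.subspace_0 hv.subspace_add hv.subspace_scale)

text \<open>\<open>ha i\<close> is the scalar 1/2 on \<open>hp i k\<close>, which puts residue
  \<open>i\<close> into \<open>I\<close>; \<open>ha (i + 1)\<close> then yields residue
  \<open>i - 1\<close>, and the sum relation the third. The neighbours of \<open>ha i\<close> follow
  once \<open>hs 1\<close> is in \<open>I\<close>.\<close>

lemma hideal_with_ha_step:
  assumes I: "hideal (I :: 'a hvec set)" and a: "ha i \<in> I"
  shows "p_space \<subseteq> I" "ha (i + 1) \<in> I" "ha (i - 1) \<in> I"
proof -
  note sub = hideal_subspace[OF I]
  note mult = hideal_mult[OF I]
  note closed = hv.subspace_scale[OF sub] hv.subspace_add[OF sub] hv.subspace_diff[OF sub]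
  have 0: "hp i k \<in> I" for k
  proof -
    have "hp (-(i + i)) k = (hp i k :: 'a hvec)" by (rule hp_cong) presburger
    then have "hp i k = vsmul 2 (hmult (hp i k) (ha i) :: 'a hvec)"
      by (subst hmult_commute) (simp add: basis_products, simp add: coordwise field_simps)
    with closed mult[OF _ a] show ?thesis by (metis hp_in_hcarrier)
  qed
  have 1: "hp (i - 1) k \<in> I" for k
  proof -
    have "hp (-(i + 1 + i)) k = (hp (i - 1) k :: 'a hvec)" by (rule hp_cong) presburger
    then have "hp (i - 1) k = vsmul (3/2) (hp i k) - (hmult (ha (i + 1)) (hp i k) :: 'a hvec)"
      by (simp add: basis_products)
    with closed 0 mult[OF _ 0] show ?thesis by (metis ha_in_hcarrier)
  qed
  have 2: "hp (i + 1) k \<in> I" for k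
  proof -
    have "0 - hp i k - hp (i - 1) k \<in> I"
      by (intro closed 0 1 hv.subspace_0[OF sub])
    also have "0 - hp i k - hp (i - 1) k = hp (i + 1) k"
      by (rule sum_zero_solve[OF hp_sum_zero, symmetric])
    finally show ?thesis .
  qed
  have "hp r k \<in> I" for r k
  proof (cases "r - i" rule: mod3_cases)
    case 1
    then have "r mod 3 = i mod 3" by (simp add: mod_eq_dvd_iff mod_eq_0_iff_dvd)
    then show ?thesis using 0 hp_cong by metis
  next
    case 2
    then have "(r - i - 1) mod 3 = 0" by presburger
    then have "r mod 3 = (i + 1) mod 3" by (simp add: mod_eq_dvd_iff mod_eq_0_iff_dvd algebra_simps)
    then show ?thesis using \<open>\<And>k. hp (i + 1) k \<in> I\<close> hp_cong by metis
  next
    case 3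
    then have "(r - i + 1) mod 3 = 0" by presburger
    then have "r mod 3 = (i - 1) mod 3" by (simp add: mod_eq_dvd_iff mod_eq_0_iff_dvd algebra_simps)
    then show ?thesis using \<open>\<And>k. hp (i - 1) k \<in> I\<close> hp_cong by metis
  qed
  then show P: "p_space \<subseteq> I" by (rule p_space_minimal[OF sub])
  define x1 x2 x3 where "x1 = vsmul 2 (hmult (ha (i + 1)) (ha i)) - (ha i :: 'a hvec)"
    and "x2 = vsmul 2 (hmult (ha (i - 1)) (ha i)) - (ha i :: 'a hvec)"
    and "x3 = vsmul 2 (hmult (ha (i + 2)) (ha i)) - (ha i :: 'a hvec)"
  have x_mem: "x1 \<in> I" "x2 \<in> I" "x3 \<in> I"
    unfolding x1_def x2_def x3_def by (intro closed mult a ha_in_hcarrier)+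
  have x: "x1 = ha (i + 1) + vsmul 2 (hs 1)" "x2 = ha (i - 1) + vsmul 2 (hs 1)"
    "x3 = ha (i + 2) + vsmul 2 (hs 2)"
    unfolding x1_def x2_def x3_def
    by (simp_all add: basis_products hz_not_dvd) (simp_all add: coordwise field_simps One_nat_def)
  define x4 x5 where "x4 = hmult (ha (i + 1)) x2" and "x5 = N1 x1"
  have x5_mem: "x4 \<in> I" "x5 \<in> I"
    unfolding x4_def x5_def by (intro mult x_mem ha_in_hcarrier hs_in_hcarrier)+
  \<comment> \<open>The first bracket equals 4 \<open>hs 1\<close> minus 1/2 \<open>hs 2\<close>,
    the second 6 \<open>hs 1\<close> minus 3/2 \<open>hs 2\<close>; the factors 1/2 and 1/6
    eliminate \<open>hs 2\<close>.\<close>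
  have "hs 1 = vsmul (1/2) (x4 + x1 - vsmul (1/2) x2 - vsmul (3/4) (ha i) - vsmul (3/4) x3)
      - vsmul (1/6) (x5 + vsmul (3/4) x1 - vsmul (3/8) (ha i) - vsmul (3/8) x3)"
    unfolding x4_def x5_def x
    by (simp add: basis_products hz_not_dvd) (simp add: coordwise field_simps)
  also have "\<dots> \<in> I"
    by (intro closed x_mem x5_mem a)
  finally have "hs 1 \<in> I" .
  with x x_mem closed(1,3) show "ha (i + 1) \<in> I" "ha (i - 1) \<in> I"
    by (metis add_diff_cancel_right')+
qed

lemma hideal_with_ha:
  assumes I: "hideal (I :: 'a hvec set)" and a: "ha 0 \<in> I"
  shows "I = hcarrier"
proof
  note sub = hideal_subspace[OF I]
  note closed = hv.subspace_scale[OF sub] hv.subspace_add[OF sub] hv.subspace_diff[OF sub]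
  have A: "ha i \<in> I" for i
    by (induction i rule: int_induct[where k = 0]) (use a hideal_with_ha_step[OF I] in auto)
  have P: "hp r k \<in> I" for r k
    using hideal_with_ha_step(1)[OF I a] by auto
  have "hs j \<in> I" for j
  proof -
    have "hs j = hmult (ha (int j)) (ha 0) - vsmul (1/2) (ha (int j) + ha 0) - (hz (int j) j :: 'a hvec)"
      by (simp add: basis_products)
    also have "\<dots> \<in> I"
      unfolding hz_def vsub_eq_minus by (intro closed A P hideal_mult[OF I] ha_in_hcarrier)
    finally show ?thesis .
  qed
  with A P show "hcarrier \<subseteq> I" by (intro hcarrier_subset[OF sub])
qed (use hideal_in_hcarrier[OF I] in blast)

lemma A0_ha0: "A0 (ha 0) = (ha 0 :: 'a hvec)"
  by (simp add: basis_products) (simp add: coordwise)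

text \<open>Applying \<open>A0\<close> minus 0, 2 and 1/2 removes the eigencomponents up to terms in
  \<open>p_space\<close>, and \<open>A0\<close> minus 1/2 and 5/2 removes those. As
  \<open>A0\<close> fixes \<open>ha 0\<close>, its coefficient becomes 3/8
  \<open>\<alpha>\<close>.\<close>

lemma hideal_weight_nonzero:
  assumes I: "hideal (I :: 'a hvec set)"
    and mem: "vsmul \<alpha> (ha 0) + u0 t + u2 t' + d + p \<in> I"
    and "t \<in> s_space" "t' \<in> s_space" "d \<in> d_space" "p \<in> p_space" and "\<alpha> \<noteq> 0"
  shows "I = hcarrier"
proof -
  note sub = hideal_subspace[OF I]
  have step: "A0 x - vsmul c x \<in> I" if "x \<in> I" for c x
    by (intro hv.subspace_scale hv.subspace_diff sub hideal_mult[OF I] that ha_in_hcarrier)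
  note u_closed [simp] = linop_closed[OF linop_u0] linop_closed[OF linop_u2]
  note [simp] = assms(3-6)
  define p1 where "p1 = vsmul (-(5/2)) (zeta t) + vsmul (3/4) (zeta t') + A0 p"
  have p1 [simp]: "p1 \<in> p_space" by (simp add: p1_def p_space_closed ha_p_space)
  have "A0 (vsmul \<alpha> (ha 0) + u0 t + u2 t' + d + p) - vsmul 0 (vsmul \<alpha> (ha 0) + u0 t + u2 t' + d + p)
      = vsmul \<alpha> (ha 0) + vsmul 2 (u2 t') + vsmul (1/2) d + p1"
    by (simp add: A0_ha0 A0_u0 A0_u2 A0_d_space p1_def)
  with step[OF mem] have 1: "vsmul \<alpha> (ha 0) + vsmul 2 (u2 t') + vsmul (1/2) d + p1 \<in> I" by metis
  define p2 where "p2 = vsmul (3/2) (zeta t') + A0 p1 - vsmul 2 p1"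
  have p2 [simp]: "p2 \<in> p_space" by (simp add: p2_def p_space_closed ha_p_space)
  have "A0 (vsmul \<alpha> (ha 0) + vsmul 2 (u2 t') + vsmul (1/2) d + p1)
      - vsmul 2 (vsmul \<alpha> (ha 0) + vsmul 2 (u2 t') + vsmul (1/2) d + p1)
      = vsmul (- \<alpha>) (ha 0) - vsmul (3/4) d + p2"
    by (simp add: A0_ha0 A0_u0 A0_u2 A0_d_space p2_def) (simp add: coordwise field_simps)
  with step[OF 1] have 2: "vsmul (- \<alpha>) (ha 0) - vsmul (3/4) d + p2 \<in> I" by metis
  have "A0 p2 - vsmul (1/2) p2 \<in> p_space" by (simp add: p_space_closed ha_p_space)
  then obtain q r where qr: "A0 p2 - vsmul (1/2) p2 = PZ q + PH r" by (rule p_space_eq_ev)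
  have "A0 (vsmul (- \<alpha>) (ha 0) - vsmul (3/4) d + p2)
      - vsmul (1/2) (vsmul (- \<alpha>) (ha 0) - vsmul (3/4) d + p2)
      = vsmul (-(1/2) * \<alpha>) (ha 0) + (A0 p2 - vsmul (1/2) p2)"
    by (simp add: A0_ha0 A0_d_space) (simp add: coordwise field_simps)
  with step[OF 2] qr have 3: "vsmul (-(1/2) * \<alpha>) (ha 0) + (PZ q + PH r) \<in> I" by metis
  have "A0 (vsmul (-(1/2) * \<alpha>) (ha 0) + (PZ q + PH r)) - vsmul (1/2) (vsmul (-(1/2) * \<alpha>) (ha 0) + (PZ q + PH r))
      = vsmul (-(1/4) * \<alpha>) (ha 0) + vsmul 2 (PZ q)"
    by (simp add: A0_ha0 A_PZ_PH) (simp add: coordwise field_simps)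
  with step[OF 3] have 4: "vsmul (-(1/4) * \<alpha>) (ha 0) + vsmul 2 (PZ q) \<in> I" by metis
  have "A0 (vsmul (-(1/4) * \<alpha>) (ha 0) + vsmul 2 (PZ q)) - vsmul (5/2) (vsmul (-(1/4) * \<alpha>) (ha 0) + vsmul 2 (PZ q))
      = vsmul (3/8 * \<alpha>) (ha 0)"
    by (simp add: A0_ha0 A_PZ_PH) (simp add: coordwise field_simps)
  with step[OF 4] have "vsmul (3/8 * \<alpha>) (ha 0) \<in> I" by metis
  then have "vsmul (8/3 * inverse \<alpha>) (vsmul (3/8 * \<alpha>) (ha 0)) \<in> I"
    by (rule hv.subspace_scale[OF sub])
  with \<open>\<alpha> \<noteq> 0\<close> have "ha 0 \<in> I" by simp
  with I show ?thesis by (rule hideal_with_ha)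
qed

section \<open>Ideals of elements of weight zero\<close>

lemma p_space_ideal_psum:
  assumes I: "hideal (I :: 'a hvec set)"
  shows "p_space_ideal (psum I)"
  unfolding p_space_ideal_def
proof (intro conjI ballI subsetI)
  note sub = hideal_subspace[OF I]
  show "hv.subspace (psum I)"
    unfolding psum_def by (rule hv.subspace_sums[OF sub subspace_p_space])
next
  fix x :: "'a hvec" assume "x \<in> p_space"
  then have "0 + x \<in> psum I"
    unfolding psum_def using hv.subspace_0[OF hideal_subspace[OF I]] by blast
  then show "x \<in> psum I" by simp
next
  fix x assume "x \<in> psum I"
  then obtain y p where x: "x = y + p" "y \<in> I" "p \<in> p_space" by (auto simp: psum_def)
  note [simp] = hideal_in_hcarrier[OF I x(2)] x(3)
  show "x \<in> hcarrier" by (simp add: x(1))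
  have "A0 x = A0 y + A0 p" "N1 x = N1 y + N1 p" by (simp_all add: x(1))
  moreover have "A0 y \<in> I" "N1 y \<in> I" by (simp_all add: hideal_mult[OF I] x(2))
  moreover have "A0 p \<in> p_space" "N1 p \<in> p_space" by (simp_all add: ha_p_space N1_p_space p_space_closed)
  ultimately show "A0 x \<in> psum I" "N1 x \<in> psum I" unfolding psum_def by blast+
qed

context
  fixes Q :: "'a hvec set"
  assumes Q: "p_space_ideal Q"
begin

lemma p_space_ideal_closed:
  "0 \<in> Q" "x \<in> Q \<Longrightarrow> y \<in> Q \<Longrightarrow> x + y \<in> Q" "x \<in> Q \<Longrightarrow> y \<in> Q \<Longrightarrow> x - y \<in> Q"
  "x \<in> Q \<Longrightarrow> vsmul c x \<in> Q" "x \<in> Q \<Longrightarrow> A0 x \<in> Q" "x \<in> Q \<Longrightarrow> N1 x \<in> Q"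
  and p_space_in_p_space_ideal: "p \<in> p_space \<Longrightarrow> p \<in> Q"
  using Q by (auto simp: p_space_ideal_def hv.subspace_0 hv.subspace_add hv.subspace_diff hv.subspace_scale)

lemma p_space_ideal_Lop: "x \<in> Q \<Longrightarrow> Lop x \<in> Q"
  unfolding Lop_def by (intro p_space_ideal_closed)

lemma p_space_ideal_mod: "x + p \<in> Q \<Longrightarrow> p \<in> p_space \<Longrightarrow> x \<in> Q"
  using p_space_ideal_closed(3)[of "x + p" p] p_space_in_p_space_ideal by simp

lemma p_space_ideal_u0_N1: "t \<in> s_space \<Longrightarrow> u0 t \<in> Q \<Longrightarrow> u0 (N1 t) \<in> Q"
  by (rule p_space_ideal_mod[of _ "vsmul (1/2) (zeta (N1 t)) - vsmul (15/8) (zeta t)"])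
    (auto simp: p_space_closed p_space_ideal_Lop simp flip: Lop_u0)

lemma p_space_ideal_u2_N1: "t \<in> s_space \<Longrightarrow> u2 t \<in> Q \<Longrightarrow> u2 (N1 t) \<in> Q"
  by (rule p_space_ideal_mod[of _ "vsmul (9/4) (zeta (N1 t)) + vsmul (9/16) (zeta t)"])
    (auto simp: p_space_closed p_space_ideal_Lop simp flip: Lop_u2)

text \<open>Multiplication by the variable is realised by \<open>Lop\<close> on the first two
  components and by \<open>N1\<close> on the third.\<close>

lemma poly_ideal_components:
  "poly_ideal {q. u0 (SS q) \<in> Q}" "poly_ideal {q. u2 (SS q) \<in> Q}" "poly_ideal {q. DD q \<in> Q}"
  by (rule poly_idealI; simp add: ev_add ev_smult ev_shift linop_add[OF linop_u0] linop_add[OF linop_u2]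
      linop_scale[OF linop_u0] linop_scale[OF linop_u2] linop_0[OF linop_u0] linop_0[OF linop_u2]
      p_space_ideal_closed p_space_ideal_u0_N1 p_space_ideal_u2_N1)+

text \<open>The eigenvalues 0, 2 and 1/2 of \<open>A0\<close> modulo \<open>p_space\<close> have
  invertible differences.\<close>

lemma p_space_ideal_split:
  assumes t: "t \<in> s_space" "t' \<in> s_space" "d \<in> d_space" "p \<in> p_space" and mem: "u0 t + u2 t' + d + p \<in> Q"
  shows "u0 t \<in> Q" "u2 t' \<in> Q" "d \<in> Q"
proof -
  note [simp] = linop_closed[OF linop_u0] linop_closed[OF linop_u2] t
  have y: "u0 t + u2 t' + d \<in> Q" using p_space_ideal_mod[OF mem] by simp
  have "A0 (u0 t + u2 t' + d) = vsmul 2 (u2 t') + vsmul (1/2) d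
      + (vsmul (3/4) (zeta t') - vsmul (5/2) (zeta t))"
    by (simp add: A0_u0 A0_u2 A0_d_space)
  with p_space_ideal_closed(5)[OF y] have y1: "vsmul 2 (u2 t') + vsmul (1/2) d \<in> Q"
    by - (rule p_space_ideal_mod[of _ "vsmul (3/4) (zeta t') - vsmul (5/2) (zeta t)"],
      simp_all only: p_space_closed zeta_in_p_space t)
  have "A0 (vsmul 2 (u2 t') + vsmul (1/2) d) = vsmul 4 (u2 t') + vsmul (1/4) d + vsmul (3/2) (zeta t')"
    by (simp add: A0_u2 A0_d_space) (simp add: coordwise field_simps)
  with p_space_ideal_closed(5)[OF y1] have y2: "vsmul 4 (u2 t') + vsmul (1/4) d \<in> Q"
    by - (rule p_space_ideal_mod[of _ "vsmul (3/2) (zeta t')"], simp_all only: p_space_closed zeta_in_p_space t)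
  have "vsmul (1/3) (vsmul 4 (u2 t') + vsmul (1/4) d - vsmul (1/2) (vsmul 2 (u2 t') + vsmul (1/2) d)) \<in> Q"
    by (intro p_space_ideal_closed y1 y2)
  also have "vsmul (1/3) (vsmul 4 (u2 t') + vsmul (1/4) d - vsmul (1/2) (vsmul 2 (u2 t') + vsmul (1/2) d)) = u2 t'"
    by (simp add: coordwise field_simps)
  finally show u2: "u2 t' \<in> Q" .
  have "vsmul 2 (vsmul 2 (u2 t') + vsmul (1/2) d - vsmul 2 (u2 t')) \<in> Q"
    by (intro p_space_ideal_closed y1 u2)
  then show d: "d \<in> Q" by simp
  have "u0 t + u2 t' + d - u2 t' - d \<in> Q"
    by (intro p_space_ideal_closed(3) y u2 d)
  then show "u0 t \<in> Q" by simp
qed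

end

text \<open>An ideal containing \<open>e\<close> contains, modulo \<open>p_space\<close>, the
  generators of all three components, hence \<open>I\<close> up to \<open>p_space\<close>;
  \<open>Dop e\<close> supplies the generator \<open>PZ k\<close> for what remains.\<close>

lemma hideal_in_kernel_principal:
  assumes I: "hideal (I :: 'a hvec set)"
    and ker: "\<And>x. x \<in> I \<Longrightarrow> \<exists>t\<in>s_space. \<exists>t'\<in>s_space. \<exists>d\<in>d_space. \<exists>p\<in>p_space. x = u0 t + u2 t' + d + p"
  shows "\<exists>e\<in>I. \<forall>J. hideal J \<and> e \<in> J \<longrightarrow> I \<subseteq> J"
proof -
  note sub = hideal_subspace[OF I]
  have Q: "p_space_ideal (psum I)" by (rule p_space_ideal_psum[OF I])
  note u_closed [simp] = linop_closed[OF linop_u0] linop_closed[OF linop_u2]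
  obtain g0 where g0: "u0 (SS g0) \<in> psum I" "\<And>q. u0 (SS q) \<in> psum I \<Longrightarrow> g0 dvd q"
    using poly_ideal_principal[OF poly_ideal_components(1)[OF Q]] by auto
  obtain g2 where g2: "u2 (SS g2) \<in> psum I" "\<And>q. u2 (SS q) \<in> psum I \<Longrightarrow> g2 dvd q"
    using poly_ideal_principal[OF poly_ideal_components(2)[OF Q]] by auto
  obtain gd where gd: "DD gd \<in> psum I" "\<And>q. DD q \<in> psum I \<Longrightarrow> gd dvd q"
    using poly_ideal_principal[OF poly_ideal_components(3)[OF Q]] by auto
  obtain k where k: "PZ k \<in> I" "\<And>q. PZ q \<in> I \<Longrightarrow> k dvd q"
    using poly_ideal_principal[OF poly_ideal_PZ[OF I]] by auto
  define y where "y = u0 (SS g0) + u2 (SS g2) + DD gd"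
  have "y \<in> psum I"
    unfolding y_def by (intro p_space_ideal_closed[OF Q] g0(1) g2(1) gd(1))
  \<comment> \<open>\<open>y\<close> itself need not lie in \<open>I\<close>; \<open>x0\<close> is a
    representative in \<open>I\<close>.\<close>
  then obtain x0 p0 where x0: "y = x0 + p0" "x0 \<in> I" "p0 \<in> p_space"
    by (auto simp: psum_def)
  have x0_eq: "x0 = y - p0" using x0(1) by simp
  have DI: "Dop x \<in> I" if "x \<in> I" for x
    unfolding Dop_def Lop_def
    by (intro hv.subspace_add[OF sub] hv.subspace_diff[OF sub] hv.subspace_scale[OF sub]
        hideal_mult[OF I] that ha_in_hcarrier hs_in_hcarrier)
  have "Dop p0 \<in> p_space"
    unfolding Dop_def by (simp add: Lop_p_space N1_p_space p_space_closed x0(3))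
  then have "Dop x0 \<in> p_space"
    unfolding x0_eq y_def using x0(3)
    by (simp add: linop_add[OF linop_Dop] linop_diff[OF linop_Dop] Dop_u Dop_d_space p_space_closed)
  then obtain m m' where m: "Dop x0 = PZ m + PH m'" by (rule p_space_eq_ev)
  with DI[OF x0(2)] have mI: "PZ m \<in> I" using hideal_p_space_split(1)[OF I] by metis
  text \<open>On the component of \<open>p_space\<close> spanned by the \<open>hz 0 k\<close> the operator \<open>Dop\<close> is the scalar \<open>9/2\<close>; this
    choice of \<open>h\<close> turns that component of \<open>Dop e\<close> into the generator \<open>PZ k\<close>.\<close>
  define h where "h = smult (2/9) (k - m)"
  have PZh: "PZ h = vsmul (2/9) (PZ k - PZ m)"
  proof -
    have "PZ (k - m) + PZ m = PZ k" by (simp flip: ev_add)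
    then have "PZ (k - m) = PZ k - PZ m" by (simp add: eq_diff_eq)
    then show ?thesis by (simp add: h_def ev_smult)
  qed
  define e where "e = x0 + PZ h"
  have "PZ h \<in> I"
    unfolding PZh by (intro hv.subspace_scale[OF sub] hv.subspace_diff[OF sub] k(1) mI)
  then have eI: "e \<in> I" unfolding e_def using x0(2) hv.subspace_add[OF sub] by blast
  have "Dop e = PZ m + PH m' + vsmul (9/2) (PZ h)"
    unfolding e_def using hideal_in_hcarrier[OF I x0(2)]
    by (simp add: linop_add[OF linop_Dop] m Dop_PZ)
  then have De: "Dop e = PZ k + PH m'"
    unfolding PZh by (simp add: coordwise field_simps)
  have "I \<subseteq> J" if J: "hideal J" "e \<in> J" for J
  proof
    fix x assume xI: "x \<in> I"
    \<comment> \<open>Intersecting with \<open>I\<close> ensures that the error \<open>p'\<close>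
      below lies in \<open>I\<close>, so that \<open>k\<close> divides its coordinates.\<close>
    define J' where "J' = J \<inter> I"
    have J': "hideal J'" and eJ: "e \<in> J'"
      using J I eI by (auto simp: J'_def hideal_Int)
    note subJ = hideal_subspace[OF J']
    have Q': "p_space_ideal (psum J')" by (rule p_space_ideal_psum[OF J'])
    have "y = e + (p0 - PZ h)" by (simp add: e_def x0(1))
    moreover have "p0 - PZ h \<in> p_space" by (simp add: p_space_closed x0(3))
    ultimately have "y \<in> psum J'" using eJ unfolding psum_def by blast
    then have "u0 (SS g0) + u2 (SS g2) + DD gd + 0 \<in> psum J'" by (simp add: y_def)
    from p_space_ideal_split[OF Q' _ _ _ _ this]
    have gJ: "u0 (SS g0) \<in> psum J'" "u2 (SS g2) \<in> psum J'" "DD gd \<in> psum J'"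
      by (simp_all add: p_space_closed)
    obtain t t' d p where t: "t \<in> s_space" "t' \<in> s_space" "d \<in> d_space" "p \<in> p_space"
      and x: "x = u0 t + u2 t' + d + p"
      using ker[OF xI] by blast
    have "x + 0 \<in> psum I"
      unfolding psum_def using xI p_space_closed(1) by blast
    then have "x \<in> psum I" by simp
    from p_space_ideal_split[OF Q t this[unfolded x]]
    have comps: "u0 t \<in> psum I" "u2 t' \<in> psum I" "d \<in> psum I" .
    obtain q0 where q0: "t = SS q0" using s_space_eq_ev[OF t(1)] .
    obtain q2 where q2: "t' = SS q2" using s_space_eq_ev[OF t(2)] .
    obtain qd where qd: "d = DD qd" using d_space_eq_ev[OF t(3)] .
    have "u0 t \<in> psum J'"
      using dvd_in_poly_ideal[OF poly_ideal_components(1)[OF Q'], of g0 q0] g0(2) comps(1) gJ(1) q0 by simp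
    moreover have "u2 t' \<in> psum J'"
      using dvd_in_poly_ideal[OF poly_ideal_components(2)[OF Q'], of g2 q2] g2(2) comps(2) gJ(2) q2 by simp
    moreover have "d \<in> psum J'"
      using dvd_in_poly_ideal[OF poly_ideal_components(3)[OF Q'], of gd qd] gd(2) comps(3) gJ(3) qd by simp
    ultimately have "x \<in> psum J'"
      unfolding x by (intro p_space_ideal_closed(2)[OF Q'] p_space_in_p_space_ideal[OF Q' t(4)])
    then obtain j p' where j: "x = j + p'" "j \<in> J'" "p' \<in> p_space" by (auto simp: psum_def)
    have "Dop e \<in> J'"
      using DI[OF eI] unfolding Dop_def Lop_def
      by (intro hv.subspace_add[OF subJ] hv.subspace_diff[OF subJ] hv.subspace_scale[OF subJ]
        hideal_mult[OF J'] eJ ha_in_hcarrier hs_in_hcarrier)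
    with De have kJ: "PZ k \<in> J'" using hideal_p_space_split(1)[OF J'] by metis
    have PZJ: "PZ q \<in> J'" if "PZ q \<in> I" for q
      using dvd_in_poly_ideal[OF poly_ideal_PZ[OF J'], of k q] k(2)[OF that] kJ by simp
    obtain q r where qr: "p' = PZ q + PH r" using p_space_eq_ev[OF j(3)] .
    have "x - j \<in> I" using xI j(2) by (intro hv.subspace_diff[OF sub]) (auto simp: J'_def)
    then have "PZ q + PH r \<in> I" using j(1) qr by simp
    from hideal_p_space_split[OF I this] have "PZ q \<in> I" "PZ r \<in> I"
      using hideal_PZ_iff_PH[OF I] by blast+
    then have "PZ q \<in> J'" "PH r \<in> J'"
      using PZJ hideal_PZ_iff_PH[OF J'] by blast+
    then have "x \<in> J'"
      unfolding j(1) qr using j(2) by (intro hv.subspace_add[OF subJ])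
    then show "x \<in> J" by (simp add: J'_def)
  qed
  with eI show ?thesis by blast
qed

text \<open>Either \<open>ha 0\<close> generates, or no element of \<open>I\<close> has nonzero
  weight.\<close>

lemma hideal_principal:
  assumes I: "hideal (I :: 'a hvec set)"
  shows "\<exists>e\<in>I. \<forall>J. hideal J \<and> e \<in> J \<longrightarrow> I \<subseteq> J"
proof (cases "ha 0 \<in> I")
  case True
  then have "I \<subseteq> J" if "hideal J" "ha 0 \<in> J" for J
    using hideal_with_ha[OF that] hideal_in_hcarrier[OF I] by blast
  with True show ?thesis by blast
next
  case False
  have "\<exists>t\<in>s_space. \<exists>t'\<in>s_space. \<exists>d\<in>d_space. \<exists>p\<in>p_space. x = u0 t + u2 t' + d + p" if "x \<in> I" for x
  proof -
    obtain \<alpha> t t' d p where t: "t \<in> s_space" "t' \<in> s_space" "d \<in> d_space" "p \<in> p_space"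
      and x: "x = vsmul \<alpha> (ha 0) + u0 t + u2 t' + d + p"
      using hcarrier_decomp[OF hideal_in_hcarrier[OF I \<open>x \<in> I\<close>]] .
    have "\<alpha> = 0"
    proof (rule ccontr)
      assume "\<alpha> \<noteq> 0"
      with \<open>x \<in> I\<close> have "I = hcarrier"
        unfolding x by (rule hideal_weight_nonzero[OF I _ t])
      with False show False by simp
    qed
    with x have "x = u0 t + u2 t' + d + p" by simp
    with t show ?thesis by blast
  qed
  with I show ?thesis by (rule hideal_in_kernel_principal)
qed

end

theorem theorem1p5:
  fixes I :: "('a::field) hvec set"
  assumes "(2::'a) \<noteq> 0" and "(3::'a) \<noteq> 0"
    and "hideal I"
  shows "\<exists>a\<in>hcarrier. I = hgen_ideal a"
proof -
  obtain e where e: "e \<in> I" "\<And>J. hideal J \<Longrightarrow> e \<in> J \<Longrightarrow> I \<subseteq> J"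
    using hideal_principal[OF assms] by blast
  with \<open>hideal I\<close> have "I = hgen_ideal e"
    unfolding hgen_ideal_def by blast
  with hideal_in_hcarrier[OF \<open>hideal I\<close> e(1)] show ?thesis by blast
qed

end
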